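(* There exists an algorithm that, given as input a graph $G=(V,E)$ with $n$ vertices together with $k$ subsets $N_1,\dots,N_k\subseteq V$ (equivalently, a label for every vertex $x\in V$, namely the $0/1$-vector of length $k$ whose $i$-th entry is $1$ if and only if $x\in N_i$), decides in $O(k\cdot n^5)$ time whether $G$ is a labeled $k$-probe cograph with respect to $N_1,\dots,N_k$.
   Context: A cograph is a graph with no induced path on four vertices ($P_4$). The sets $N_1,\dots,N_k$ need not be disjoint. The graph $G$ is called a (labeled) $k$-probe cograph with respect to $N_1,\dots,N_k$ if each $N_i$ is an independent set in $G$ and there exists a cograph $H=(V,E')$ with $E\subseteq E'$ such that every edge $\{x,y\}\in E'\setminus E$ has both endpoints in a common set $N_i$; equivalently, $G$ is obtained from some cograph $H$ on $V$ by removing every edge $\{x,y\}$ of $H$ for which some $N_i$ contains both $x$ and $y$. In the labeled recognition problem the sets $N_i$ (i.e. the vertex labels) are part of the input. *)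

theory Defs
  imports Main
begin

section \<open>Graphs, cographs and labeled probe cographs\<close>

definition simple_graph :: "'a set \<Rightarrow> 'a set set \<Rightarrow> bool" where
  "simple_graph V E \<longleftrightarrow> finite V \<and> (\<forall>e\<in>E. e \<subseteq> V \<and> card e = 2)"

definition induced_P4 :: "'a set \<Rightarrow> 'a set set \<Rightarrow> 'a \<Rightarrow> 'a \<Rightarrow> 'a \<Rightarrow> 'a \<Rightarrow> bool" where
  "induced_P4 V E a b c d \<longleftrightarrow>
     {a, b, c, d} \<subseteq> V \<and> distinct [a, b, c, d] \<and>
     {a, b} \<in> E \<and> {b, c} \<in> E \<and> {c, d} \<in> E \<and>
     {a, c} \<notin> E \<and> {a, d} \<notin> E \<and> {b, d} \<notin> E"

definition cograph :: "'a set \<Rightarrow> 'a set set \<Rightarrow> bool" where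
  "cograph V E \<longleftrightarrow> simple_graph V E \<and> (\<nexists>a b c d. induced_P4 V E a b c d)"

definition independent_set :: "'a set set \<Rightarrow> 'a set \<Rightarrow> bool" where
  "independent_set E S \<longleftrightarrow> (\<forall>x\<in>S. \<forall>y\<in>S. {x, y} \<notin> E)"

text \<open>The sets \<open>N\<^sub>1, \<dots>, N\<^sub>k\<close> form a list of length \<open>k\<close>; they may overlap, coincide or be empty.\<close>

definition labeled_probe_cograph :: "'a set \<Rightarrow> 'a set set \<Rightarrow> 'a set list \<Rightarrow> bool" where
  "labeled_probe_cograph V E Ns \<longleftrightarrow>
     (\<forall>N\<in>set Ns. independent_set E N) \<and>
     (\<exists>E'. cograph V E' \<and> E \<subseteq> E' \<and>
        (\<forall>x y. {x, y} \<in> E' - E \<longrightarrow> (\<exists>N\<in>set Ns. x \<in> N \<and> y \<in> N)))"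


section \<open>A word RAM\<close>

text \<open>
  Algorithms are structured programs for a unit-cost random access machine with finitely many
  used registers and a memory with indirect addressing. Every operator, constant, register access
  and memory access in an expression costs one step. So that unit cost is not exploited by means
  of huge numbers, each machine has a bound \<open>W\<close> below which all intermediate values and
  addresses must lie; a program that leaves this range has no execution at all. Programs cannot
  access \<open>W\<close>.
\<close>

record state =
  regs :: "nat \<Rightarrow> nat"
  mem :: "nat \<Rightarrow> nat"

datatype aexp = Const nat | Reg nat | Load aexp
  | Add aexp aexp | Sub aexp aexp | Mul aexp aexp

datatype bexp = Less aexp aexp | Equal aexp aexp | BNot bexp | BAnd bexp bexp

datatype com = Skip
  | Assign nat aexp
  | Store aexp aexp \<comment> \<open>address, value\<close>
  | Seq com com
  | Cond bexp com com
  | While bexp com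

fun aval :: "aexp \<Rightarrow> state \<Rightarrow> nat" where
  "aval (Const m) s = m"
| "aval (Reg r) s = regs s r"
| "aval (Load e) s = mem s (aval e s)"
| "aval (Add e1 e2) s = aval e1 s + aval e2 s"
| "aval (Sub e1 e2) s = aval e1 s - aval e2 s"
| "aval (Mul e1 e2) s = aval e1 s * aval e2 s"

fun afits :: "nat \<Rightarrow> aexp \<Rightarrow> state \<Rightarrow> bool" where
  "afits W (Const m) s \<longleftrightarrow> m < W"
| "afits W (Reg r) s \<longleftrightarrow> regs s r < W"
| "afits W (Load e) s \<longleftrightarrow> afits W e s \<and> mem s (aval e s) < W"
| "afits W (Add e1 e2) s \<longleftrightarrow> afits W e1 s \<and> afits W e2 s \<and> aval e1 s + aval e2 s < W"
| "afits W (Sub e1 e2) s \<longleftrightarrow> afits W e1 s \<and> afits W e2 s"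
| "afits W (Mul e1 e2) s \<longleftrightarrow> afits W e1 s \<and> afits W e2 s \<and> aval e1 s * aval e2 s < W"

fun acost :: "aexp \<Rightarrow> nat" where
  "acost (Const m) = 1"
| "acost (Reg r) = 1"
| "acost (Load e) = 1 + acost e"
| "acost (Add e1 e2) = 1 + acost e1 + acost e2"
| "acost (Sub e1 e2) = 1 + acost e1 + acost e2"
| "acost (Mul e1 e2) = 1 + acost e1 + acost e2"

fun bval :: "bexp \<Rightarrow> state \<Rightarrow> bool" where
  "bval (Less e1 e2) s \<longleftrightarrow> aval e1 s < aval e2 s"
| "bval (Equal e1 e2) s \<longleftrightarrow> aval e1 s = aval e2 s"
| "bval (BNot b) s \<longleftrightarrow> \<not> bval b s"
| "bval (BAnd b1 b2) s \<longleftrightarrow> bval b1 s \<and> bval b2 s"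

fun bfits :: "nat \<Rightarrow> bexp \<Rightarrow> state \<Rightarrow> bool" where
  "bfits W (Less e1 e2) s \<longleftrightarrow> afits W e1 s \<and> afits W e2 s"
| "bfits W (Equal e1 e2) s \<longleftrightarrow> afits W e1 s \<and> afits W e2 s"
| "bfits W (BNot b) s \<longleftrightarrow> bfits W b s"
| "bfits W (BAnd b1 b2) s \<longleftrightarrow> bfits W b1 s \<and> bfits W b2 s"

fun bcost :: "bexp \<Rightarrow> nat" where
  "bcost (Less e1 e2) = 1 + acost e1 + acost e2"
| "bcost (Equal e1 e2) = 1 + acost e1 + acost e2"
| "bcost (BNot b) = 1 + bcost b"
| "bcost (BAnd b1 b2) = 1 + bcost b1 + bcost b2"

text \<open>
  \<open>exec W p s t s'\<close>: on the machine with bound \<open>W\<close>, program \<open>p\<close> started in \<open>s\<close> halts in \<open>s'\<close>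
  after exactly \<open>t\<close> steps.
\<close>

inductive exec :: "nat \<Rightarrow> com \<Rightarrow> state \<Rightarrow> nat \<Rightarrow> state \<Rightarrow> bool" for W where
  Skip: "exec W Skip s 1 s"
| Assign: "afits W e s \<Longrightarrow>
    exec W (Assign r e) s (1 + acost e) (s\<lparr>regs := (regs s)(r := aval e s)\<rparr>)"
| Store: "afits W e1 s \<Longrightarrow> afits W e2 s \<Longrightarrow>
    exec W (Store e1 e2) s (1 + acost e1 + acost e2)
      (s\<lparr>mem := (mem s)(aval e1 s := aval e2 s)\<rparr>)"
| Seq: "exec W p s t1 s' \<Longrightarrow> exec W q s' t2 s'' \<Longrightarrow> exec W (Seq p q) s (t1 + t2) s''"
| CondTrue: "bfits W b s \<Longrightarrow> bval b s \<Longrightarrow> exec W p s t s' \<Longrightarrow>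
    exec W (Cond b p q) s (1 + bcost b + t) s'"
| CondFalse: "bfits W b s \<Longrightarrow> \<not> bval b s \<Longrightarrow> exec W q s t s' \<Longrightarrow>
    exec W (Cond b p q) s (1 + bcost b + t) s'"
| WhileFalse: "bfits W b s \<Longrightarrow> \<not> bval b s \<Longrightarrow> exec W (While b p) s (1 + bcost b) s"
| WhileTrue: "bfits W b s \<Longrightarrow> bval b s \<Longrightarrow> exec W p s t1 s' \<Longrightarrow>
    exec W (While b p) s' t2 s'' \<Longrightarrow> exec W (While b p) s (1 + bcost b + t1 + t2) s''"

text \<open>Final state and running time are unique, so asserting the existence of a suitable
  execution says something about the only one there is.\<close>

inductive_cases exec_elims:
  "exec W Skip s t s'"
  "exec W (Assign r e) s t s'"
  "exec W (Store e1 e2) s t s'"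
  "exec W (Seq p q) s t s'"
  "exec W (Cond b p q) s t s'"
  "exec W (While b p) s t s'"

lemma exec_deterministic:
  "exec W p s t s' \<Longrightarrow> exec W p s u s'' \<Longrightarrow> u = t \<and> s'' = s'"
proof (induction arbitrary: u s'' rule: exec.induct)
  case (Skip s)
  from Skip.prems show ?case by (rule exec_elims) simp
next
  case (Assign e s r)
  from Assign.prems show ?case by (rule exec_elims) simp
next
  case (Store e1 s e2)
  from Store.prems show ?case by (rule exec_elims) simp
next
  case (Seq p s t1 s' q t2 s3)
  from Seq.prems show ?case by (rule exec_elims) (use Seq.IH in fastforce)
next
  case (CondTrue b s p t s' q)
  from CondTrue.prems show ?case
    by (rule exec_elims) (use CondTrue.IH CondTrue.hyps(2) in fastforce)+
next
  case (CondFalse b s q t s' p)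
  from CondFalse.prems show ?case
    by (rule exec_elims) (use CondFalse.IH CondFalse.hyps(2) in fastforce)+
next
  case (WhileFalse b s p)
  from WhileFalse.prems show ?case
    by (rule exec_elims) (use WhileFalse.hyps(2) in fastforce)+
next
  case (WhileTrue b s p t1 s' t2 s3)
  from WhileTrue.prems show ?case
    by (rule exec_elims) (use WhileTrue.IH WhileTrue.hyps(2) in fastforce)+
qed


section \<open>Input encoding\<close>

text \<open>
  The vertices are \<open>0, \<dots>, n - 1\<close>. Cells 0 and 1 hold \<open>n\<close> and \<open>k\<close>; then come the adjacency matrix,
  row by row, and the label vectors of length \<open>k\<close>, vertex by vertex. All other cells and all
  registers are 0 initially.
\<close>

definition input_mem :: "nat \<Rightarrow> nat set set \<Rightarrow> nat set list \<Rightarrow> nat \<Rightarrow> nat" where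
  "input_mem n E Ns a =
     (let k = length Ns; b = a - 2; l = a - (2 + n * n) in
      if a = 0 then n
      else if a = 1 then k
      else if a < 2 + n * n then of_bool ({b div n, b mod n} \<in> E)
      else if a < 2 + n * n + n * k then of_bool (l div k \<in> Ns ! (l mod k))
      else 0)"

definition input_state :: "nat \<Rightarrow> nat set set \<Rightarrow> nat set list \<Rightarrow> state" where
  "input_state n E Ns = \<lparr>regs = (\<lambda>_. 0), mem = input_mem n E Ns\<rparr>"

end

theory Submission
  imports Defs
begin

text \<open>
  The question is whether a cograph exists between the mandatory edges and the complement of the
  forbidden ones, the forbidden pairs being the non-edges without a common label. A graph with at
  least two vertices and without induced \<open>P\<^sub>4\<close> is disconnected or has a disconnected complement,
  so in a solvable instance every part with at least two vertices falls apart with respect to the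
  mandatory or to the forbidden edges. Conversely, solutions for the components can be put together
  by disjoint union or by join, respectively. Hence, starting with a single part, one alternately
  takes components with respect to the two kinds of edges; each round decreases every part of
  size at least two in a solvable instance, so after \<open>n\<close> rounds all parts are singletons if and
  only if the instance is solvable. A round takes time \<open>O(n\<^sup>3)\<close>.
\<close>

section \<open>Cograph sandwiches and partition refinement\<close>

definition splits :: "('a \<Rightarrow> 'a \<Rightarrow> bool) \<Rightarrow> 'a set \<Rightarrow> 'a set \<Rightarrow> bool" where
  "splits R C S \<longleftrightarrow> S \<noteq> {} \<and> S \<subset> C \<and> (\<forall>x\<in>S. \<forall>y\<in>C - S. \<not> R x y)"

definition P4_free_on :: "('a \<Rightarrow> 'a \<Rightarrow> bool) \<Rightarrow> 'a set \<Rightarrow> bool" where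
  "P4_free_on R C \<longleftrightarrow> (\<forall>a\<in>C. \<forall>b\<in>C. \<forall>c\<in>C. \<forall>d\<in>C. distinct [a, b, c, d] \<longrightarrow>
     R a b \<longrightarrow> R b c \<longrightarrow> R c d \<longrightarrow> \<not> R a c \<longrightarrow> \<not> R a d \<longrightarrow> \<not> R b d \<longrightarrow> False)"

lemma P4_free_onD:
  assumes "P4_free_on R C" "{a, b, c, d} \<subseteq> C" "distinct [a, b, c, d]"
    "R a b" "R b c" "R c d" "\<not> R a c" "\<not> R a d" "\<not> R b d"
  shows False
  using assms unfolding P4_free_on_def by (meson insert_subset)

lemma P4_free_on_subset: "P4_free_on R C \<Longrightarrow> D \<subseteq> C \<Longrightarrow> P4_free_on R D"
  unfolding P4_free_on_def by (meson subsetD)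

lemma P4_free_on_complement:
  assumes "symp R" "P4_free_on R C"
  shows "P4_free_on (\<lambda>x y. \<not> R x y) C"
  unfolding P4_free_on_def
proof (intro ballI impI)
  fix a b c d assume *: "a \<in> C" "b \<in> C" "c \<in> C" "d \<in> C" "distinct [a, b, c, d]"
    "\<not> R a b" "\<not> R b c" "\<not> R c d" "\<not> \<not> R a c" "\<not> \<not> R a d" "\<not> \<not> R b d"
  \<comment> \<open>the complement of the path \<open>a b c d\<close> is the path \<open>b d a c\<close>\<close>
  show False
    by (rule P4_free_onD[OF assms(2), of b d a c])
      (use * sympD[OF assms(1)] in auto)
qed

text \<open>If \<open>v\<close> sees all of \<open>C\<close>, it is isolated in the complement; if
  it misses one side of the separation, that side stays separated. Otherwise \<open>v\<close> has
  neighbours on both sides and a non-neighbour, and then its non-neighbours form a separated set: an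
  edge from them to a neighbour of \<open>v\<close> would extend to an induced path.\<close>

lemma splits_insert:
  assumes sym: "symp R" and P4: "P4_free_on R (insert v C)" and v: "v \<notin> C" and S: "splits R C S"
  shows "\<exists>S'. splits R (insert v C) S' \<or> splits (\<lambda>x y. \<not> R x y) (insert v C) S'"
proof -
  note symD = sympD[OF sym]
  have S': "S \<noteq> {}" "S \<subseteq> C" "C - S \<noteq> {}" "\<And>x y. x \<in> S \<Longrightarrow> y \<in> C - S \<Longrightarrow> \<not> R x y \<and> \<not> R y x"
    using S symD unfolding splits_def by blast+
  consider (all) "\<forall>y\<in>C. R v y" | (left) "\<forall>y\<in>S. \<not> R y v" | (right) "\<forall>y\<in>C - S. \<not> R y v"
    | (mixed) y where "y \<in> C" "\<not> R v y" "\<exists>z\<in>S. R v z" "\<exists>z\<in>C - S. R v z"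
    using symD by metis
  then show ?thesis
  proof cases
    case all
    have "splits (\<lambda>x y. \<not> R x y) (insert v C) {v}"
      using all v S' unfolding splits_def by auto
    then show ?thesis by blast
  next
    case left
    have "splits R (insert v C) S"
      using left v S' unfolding splits_def by auto
    then show ?thesis by blast
  next
    case right
    have "splits R (insert v C) (C - S)"
      using right v S' unfolding splits_def by auto
    then show ?thesis by blast
  next
    case mixed
    define U where "U = {y \<in> C. \<not> R v y}"
    have "\<not> R y z" if y: "y \<in> U" and z: "z \<in> C - U" for y z
    proof
      assume yz: "R y z"
      \<comment> \<open>A neighbour of \<open>v\<close> on the side that does not contain
        \<open>y\<close> and \<open>z\<close> serves as \<open>w\<close>; then
        \<open>y z v w\<close> is an induced path.\<close>
      obtain w where w: "w \<in> C" "R v w" "\<not> R y w" "\<not> R z w"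
      proof (cases "y \<in> S")
        case True
        then have "z \<in> S" using yz S'(4) z by blast
        then show ?thesis using mixed(4) True S'(4) that by blast
      next
        case False
        then have "y \<in> C - S" "z \<in> C - S" using yz S'(4) z y unfolding U_def by blast+
        then show ?thesis using mixed(3) S'(2,4) that by blast
      qed
      have "R z v" "\<not> R y v" using y z symD unfolding U_def by blast+
      then show False
        by (intro P4_free_onD[OF P4, of y z v w])
          (use w y z yz v in \<open>auto simp: U_def\<close>)
    qed
    then have "splits R (insert v C) U"
      using mixed(1-3) S'(2) v symD[of _ v] unfolding splits_def U_def by blast
    then show ?thesis by blast
  qed
qed

text \<open>Seinsche's theorem, by induction on the vertex set. As the path on four vertices is
  self-complementary, the insertion step applies to a separation of either kind.\<close>

lemma P4_free_splits:
  assumes "finite C" "symp R" "P4_free_on R C" "2 \<le> card C"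
  shows "\<exists>S. splits R C S \<or> splits (\<lambda>x y. \<not> R x y) C S"
  using assms(1,3,4)
proof (induction C)
  case empty
  then show ?case by simp
next
  case (insert v C)
  have P4: "P4_free_on R C" using insert.prems(1) P4_free_on_subset by blast
  show ?case
  proof (cases "2 \<le> card C")
    case True
    then obtain S where "splits R C S \<or> splits (\<lambda>x y. \<not> R x y) C S"
      using insert.IH P4 by blast
    then show ?thesis
    proof
      assume "splits R C S"
      then show ?thesis using splits_insert assms(2) insert by metis
    next
      assume S: "splits (\<lambda>x y. \<not> R x y) C S"
      have "symp (\<lambda>x y. \<not> R x y)" using assms(2) unfolding symp_def by blast
      from splits_insert[OF this P4_free_on_complement[OF assms(2) insert.prems(1)] insert.hyps(2) S]
      show ?thesis by auto
    qed
  next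
    case False
    then have "card C = 1" using insert by auto
    then obtain x where "C = {x}" using card_1_singletonE by blast
    \<comment> \<open>Two vertices are separated in the complement if they are adjacent, and in
      \<open>R\<close> otherwise.\<close>
    then have "splits R (insert v C) {v} \<or> splits (\<lambda>x y. \<not> R x y) (insert v C) {v}"
      using insert.hyps unfolding splits_def by auto
    then show ?thesis by blast
  qed
qed

section \<open>Sandwich problems on the cells of a partition\<close>

text \<open>A matrix \<open>A\<close> codes a sandwich problem: entry 1 marks a mandatory edge, entry 2 a forbidden
  one, and entry 0 an edge that may be added.\<close>

definition between :: "nat \<Rightarrow> (nat \<Rightarrow> nat \<Rightarrow> nat) \<Rightarrow> (nat \<Rightarrow> nat \<Rightarrow> bool) \<Rightarrow> bool" where
  "between n A R \<longleftrightarrow> symp R \<and>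
     (\<forall>u<n. \<forall>v<n. u \<noteq> v \<longrightarrow> (A u v = 1 \<longrightarrow> R u v) \<and> (A u v = 2 \<longrightarrow> \<not> R u v))"

text \<open>Partitions are given by labellings, of which only the equality of labels matters; the
  program stores them in this form.\<close>

definition cell :: "nat \<Rightarrow> (nat \<Rightarrow> nat) \<Rightarrow> nat \<Rightarrow> nat set" where
  "cell n L x = {y. y < n \<and> L y = L x}"

text \<open>One \<open>R\<close> serves all cells, but only paths inside a single cell are excluded.
  Thus a constant labelling gives the original problem, while an injective one excludes no
  path.\<close>

definition solvable :: "nat \<Rightarrow> (nat \<Rightarrow> nat \<Rightarrow> nat) \<Rightarrow> (nat \<Rightarrow> nat) \<Rightarrow> bool" where
  "solvable n A L \<longleftrightarrow> (\<exists>R. between n A R \<and> (\<forall>x<n. P4_free_on R (cell n L x)))"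

definition closed :: "nat \<Rightarrow> (nat \<Rightarrow> nat \<Rightarrow> nat) \<Rightarrow> nat \<Rightarrow> (nat \<Rightarrow> nat) \<Rightarrow> nat set \<Rightarrow> bool" where
  "closed n A t L S \<longleftrightarrow> (\<forall>u<n. \<forall>v<n. L u = L v \<longrightarrow> A u v = t \<longrightarrow> (u \<in> S \<longleftrightarrow> v \<in> S))"

text \<open>The cells of \<open>M\<close> are the connected components of the cells of \<open>L\<close> with respect to the
  \<open>t\<close>-edges. Connectedness is expressed by closed sets instead of paths.\<close>

definition components :: "nat \<Rightarrow> (nat \<Rightarrow> nat \<Rightarrow> nat) \<Rightarrow> nat \<Rightarrow> (nat \<Rightarrow> nat) \<Rightarrow> (nat \<Rightarrow> nat) \<Rightarrow> bool" where
  "components n A t L M \<longleftrightarrow>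
     (\<forall>u<n. \<forall>v<n. L u = L v \<longrightarrow> A u v = t \<longrightarrow> M u = M v) \<and>
     (\<forall>S. closed n A t L S \<longrightarrow> (\<forall>x<n. \<forall>y<n. M x = M y \<longrightarrow> (x \<in> S \<longleftrightarrow> y \<in> S)))"

text \<open>The vertices with the \<open>L\<close>-label of \<open>x\<close> form a closed set,
  which the classes of \<open>M\<close> cannot cross.\<close>

lemma components_refine:
  assumes "components n A t L M" "x < n" "y < n" "M x = M y"
  shows "L x = L y"
proof -
  have "closed n A t L {z. L z = L x}" unfolding closed_def by auto
  then have "x \<in> {z. L z = L x} \<longleftrightarrow> y \<in> {z. L z = L x}"
    using assms unfolding components_def by blast
  then show ?thesis by simp
qed

lemma solvable_components:
  assumes M: "components n A t L M" and t: "t = 1 \<or> t = 2" and "solvable n A M"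
  shows "solvable n A L"
proof -
  obtain R where R: "between n A R" and P4: "\<And>x. x < n \<Longrightarrow> P4_free_on R (cell n M x)"
    using assms(3) unfolding solvable_def by blast
  \<comment> \<open>Different components of one cell are combined by disjoint union if
    \<open>t = 1\<close> and by join if \<open>t = 2\<close>. Between them the matrix has no entry
    \<open>t\<close>, so neither choice violates it.\<close>
  define R' where "R' x y = (if L x = L y \<and> M x \<noteq> M y then t = 2 else R x y)" for x y
  note edge = M[unfolded components_def, THEN conjunct1, rule_format]
  have "symp R'" using R unfolding between_def R'_def symp_def by auto
  moreover have "R' u v" if "u < n" "v < n" "u \<noteq> v" "A u v = 1" for u v
    using R that t edge[of u v] unfolding between_def R'_def by auto
  moreover have "\<not> R' u v" if "u < n" "v < n" "u \<noteq> v" "A u v = 2" for u v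
    using R that t edge[of u v] unfolding between_def R'_def by auto
  ultimately have "between n A R'" unfolding between_def by blast
  moreover have "P4_free_on R' (cell n L x)" for x
    unfolding P4_free_on_def
  proof (intro ballI impI)
    fix a b c d assume *: "a \<in> cell n L x" "b \<in> cell n L x" "c \<in> cell n L x" "d \<in> cell n L x"
      "distinct [a, b, c, d]" and R': "R' a b" "R' b c" "R' c d" "\<not> R' a c" "\<not> R' a d" "\<not> R' b d"
    \<comment> \<open>a path on four vertices and its complement are both connected\<close>
    have "M a = M b \<and> M b = M c \<and> M c = M d"
      using * R' t unfolding R'_def cell_def by (auto split: if_splits)
    then show False
      using * R' P4_free_onD[OF P4[of a], of a b c d] unfolding R'_def cell_def by auto
  qed
  ultimately show ?thesis unfolding solvable_def by blast
qed

text \<open>Four distinct vertices never share a cell, so the mandatory edges alone form a solution;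
  the symmetry of \<open>A\<close> makes them a graph.\<close>

lemma solvable_inj:
  assumes "inj_on L {..<n}" "\<And>u v. u < n \<Longrightarrow> v < n \<Longrightarrow> A u v = A v u"
  shows "solvable n A L"
proof -
  define R where "R u v = (u < n \<and> v < n \<and> A u v = 1)" for u v
  have "between n A R" using assms(2) unfolding between_def R_def symp_def by auto
  moreover have "P4_free_on R (cell n L x)" if "x < n" for x
    using assms(1) unfolding P4_free_on_def cell_def inj_on_def by auto
  ultimately show ?thesis unfolding solvable_def by blast
qed

section \<open>Progress of the refinement and its outcome after \<open>n\<close> rounds\<close>

definition small_cells :: "nat \<Rightarrow> nat \<Rightarrow> (nat \<Rightarrow> nat) \<Rightarrow> bool" where
  "small_cells n r L \<longleftrightarrow> (\<forall>x<n. card (cell n L x) \<le> 1 \<or> card (cell n L x) + r \<le> n)"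

text \<open>The separating set \<open>S\<close> is closed under the \<open>t\<close>-edges, so the
  class of \<open>x\<close> stays on one side of it and misses the vertices of the other. The
  separated partition \<open>K\<close> may be coarser than \<open>L\<close>: the second pass of a
  round starts from the result \<open>M\<close> of the first, but is compared with the cells before
  the round.\<close>

lemma components_separate:
  assumes M: "components n A t L M" and sub: "\<And>y z. y < n \<Longrightarrow> z < n \<Longrightarrow> L y = L z \<Longrightarrow> K y = K z"
    and S: "splits R (cell n K x) S" and sym: "symp R"
    and R: "\<And>u v. u < n \<Longrightarrow> v < n \<Longrightarrow> u \<noteq> v \<Longrightarrow> A u v = t \<Longrightarrow> R u v"
    and x: "x < n" and MK: "\<And>y z. y < n \<Longrightarrow> z < n \<Longrightarrow> M y = M z \<Longrightarrow> K y = K z"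
  shows "cell n M x \<subset> cell n K x"
proof -
  have "closed n A t L S"
    unfolding closed_def
  proof (intro allI impI)
    fix u v assume uv: "u < n" "v < n" "L u = L v" "A u v = t"
    then have "K u = K v" using sub by blast
    then have "u \<in> cell n K x \<longleftrightarrow> v \<in> cell n K x" using uv unfolding cell_def by auto
    then show "u \<in> S \<longleftrightarrow> v \<in> S"
      using S R[OF uv(1,2) _ uv(4)] sympD[OF sym, of u v] unfolding splits_def by blast
  qed
  then have same: "y \<in> S \<longleftrightarrow> x \<in> S" if "y \<in> cell n M x" for y
    using M[unfolded components_def, THEN conjunct2, rule_format, OF _ _ x] that
    unfolding cell_def by blast
  from S obtain y z where "y \<in> S" "y \<in> cell n K x" "z \<notin> S" "z \<in> cell n K x"
    unfolding splits_def psubset_eq by blast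
  moreover have "cell n M x \<subseteq> cell n K x" using MK[OF _ x] unfolding cell_def by blast
  ultimately show ?thesis using same by blast
qed

text \<open>A cell with at least two vertices is separated in \<open>R\<close> or in its complement.
  Mandatory edges belong to \<open>R\<close> and forbidden ones to the complement, so the first or
  the second pass makes the cell strictly smaller.\<close>

lemma small_cells_round:
  assumes R: "between n A R" and P4: "P4_free_on R {..<n}"
    and M: "components n A 1 L M" and L': "components n A 2 M L'" and small: "small_cells n r L"
  shows "small_cells n (Suc r) L'"
  unfolding small_cells_def
proof (intro allI impI)
  fix x assume x: "x < n"
  have fin: "finite (cell n L x)" unfolding cell_def by auto
  have sym: "symp R" using R unfolding between_def by blast
  then have sym': "symp (\<lambda>x y. \<not> R x y)" unfolding symp_def by blast
  have sub1: "cell n M x \<subseteq> cell n L x"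
    using components_refine[OF M _ x] unfolding cell_def by blast
  have sub2: "cell n L' x \<subseteq> cell n M x"
    using components_refine[OF L' _ x] unfolding cell_def by blast
  note le = card_mono[OF fin subset_trans[OF sub2 sub1]]
  have less: "cell n L' x \<subset> cell n L x" if "2 \<le> card (cell n L x)"
  proof -
    have "P4_free_on R (cell n L x)"
      by (rule P4_free_on_subset[OF P4]) (auto simp: cell_def)
    with that obtain S where "splits R (cell n L x) S \<or> splits (\<lambda>x y. \<not> R x y) (cell n L x) S"
      using P4_free_splits[OF fin sym] by blast
    then show ?thesis
    proof
      assume S: "splits R (cell n L x) S"
      have "cell n M x \<subset> cell n L x"
        by (rule components_separate[OF M _ S sym _ x])
          (use R components_refine[OF M] in \<open>unfold between_def, blast+\<close>)
      then show ?thesis using sub2 by blast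
    next
      assume S: "splits (\<lambda>x y. \<not> R x y) (cell n L x) S"
      show ?thesis
        by (rule components_separate[OF L' _ S sym' _ x])
          (use R components_refine[OF M] components_refine[OF L'] in \<open>unfold between_def, blast+\<close>)
    qed
  qed
  show "card (cell n L' x) \<le> 1 \<or> card (cell n L' x) + Suc r \<le> n"
    using small[unfolded small_cells_def, rule_format, OF x] le less psubset_card_mono[OF fin less]
    by linarith
qed

lemma small_cells_inj:
  assumes "small_cells n n L"
  shows "inj_on L {..<n}"
proof (rule inj_onI)
  fix x y assume xy: "x \<in> {..<n}" "y \<in> {..<n}" "L x = L y"
  have fin: "finite (cell n L x)" unfolding cell_def by auto
  have sub: "{x, y} \<subseteq> cell n L x" using xy unfolding cell_def by auto
  \<comment> \<open>For \<open>r = n\<close> the second alternative of \<open>small_cells\<close>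
    would make the cell empty.\<close>
  have "card (cell n L x) \<le> 1"
    using assms xy unfolding small_cells_def by fastforce
  then show "x = y" using card_mono[OF fin sub] by (cases "x = y") auto
qed

text \<open>Solvability of the refined problem always carries back to the original one, whereas
  progress is guaranteed only for solvable instances. After \<open>n\<close> rounds the two halves
  yield the two directions of the final test.\<close>

definition refinement_inv :: "nat \<Rightarrow> (nat \<Rightarrow> nat \<Rightarrow> nat) \<Rightarrow> nat \<Rightarrow> (nat \<Rightarrow> nat) \<Rightarrow> bool" where
  "refinement_inv n A r L \<longleftrightarrow> (solvable n A L \<longrightarrow> solvable n A (\<lambda>_. 0)) \<and>
     (solvable n A (\<lambda>_. 0) \<longrightarrow> small_cells n r L)"

lemma solvable_const:
  "solvable n A (\<lambda>_. c) \<longleftrightarrow> (\<exists>R. between n A R \<and> P4_free_on R {..<n})"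
proof (cases "n = 0")
  case True
  then show ?thesis unfolding solvable_def P4_free_on_def by auto
next
  case False
  then show ?thesis unfolding solvable_def cell_def lessThan_def by auto
qed

lemma refinement_inv_init: "refinement_inv n A 0 (\<lambda>_. 0)"
proof -
  have "card (cell n (\<lambda>_. 0) x) \<le> n" for x
    using card_mono[of "{..<n}" "cell n (\<lambda>_. 0) x"] by (auto simp: cell_def)
  then show ?thesis unfolding refinement_inv_def small_cells_def by simp
qed

lemma refinement_inv_step:
  assumes "refinement_inv n A r L" "components n A 1 L M" "components n A 2 M L'"
  shows "refinement_inv n A (Suc r) L'"
  using assms solvable_components small_cells_round solvable_const
  unfolding refinement_inv_def by metis

lemma refinement_inv_inj:
  assumes "refinement_inv n A n L" "\<And>u v. A u v = A v u"
  shows "inj_on L {..<n} \<longleftrightarrow> solvable n A (\<lambda>_. 0)"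
  using assms solvable_inj small_cells_inj unfolding refinement_inv_def by metis

section \<open>Labeled probe cographs as a sandwich problem\<close>

definition shared :: "'a set list \<Rightarrow> 'a \<Rightarrow> 'a \<Rightarrow> bool" where
  "shared Ns u v \<longleftrightarrow> (\<exists>N\<in>set Ns. u \<in> N \<and> v \<in> N)"

text \<open>An edge with a common label is coded as mandatory; such an instance is rejected by the
  separate independence condition.\<close>

definition sandwich_matrix :: "nat set set \<Rightarrow> nat set list \<Rightarrow> nat \<Rightarrow> nat \<Rightarrow> nat" where
  "sandwich_matrix E Ns u v = (if {u, v} \<in> E then 1 else if shared Ns u v then 0 else 2)"

text \<open>The condition on added edges says that \<open>E'\<close> avoids every non-edge without a
  common label, so the admissible \<open>E'\<close> are the cographs in the sandwich. Independence
  concerns the input alone and becomes the first conjunct.\<close>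

lemma labeled_probe_cograph_iff_solvable:
  assumes G: "simple_graph {..<n} E" and Ns: "\<forall>N\<in>set Ns. N \<subseteq> {..<n}"
  shows "labeled_probe_cograph {..<n} E Ns \<longleftrightarrow>
    (\<forall>u<n. \<forall>v<n. \<not> ({u, v} \<in> E \<and> shared Ns u v)) \<and>
    (\<exists>R. between n (sandwich_matrix E Ns) R \<and> P4_free_on R {..<n})"
    (is "_ \<longleftrightarrow> ?ind \<and> ?sand")
proof -
  have "(\<forall>N\<in>set Ns. independent_set E N) \<longleftrightarrow> ?ind"
    using Ns unfolding independent_set_def shared_def by blast
  moreover have "?sand" if E': "cograph {..<n} E'" "E \<subseteq> E'"
    "\<forall>x y. {x, y} \<in> E' - E \<longrightarrow> (\<exists>N\<in>set Ns. x \<in> N \<and> y \<in> N)" for E'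
  proof -
    define R where "R u v = ({u, v} \<in> E')" for u v
    have "between n (sandwich_matrix E Ns) R"
      using E' unfolding between_def R_def sandwich_matrix_def shared_def symp_def
      by (auto simp: insert_commute split: if_splits)
    moreover have "P4_free_on R {..<n}"
      using E'(1) unfolding P4_free_on_def R_def cograph_def induced_P4_def by blast
    ultimately show ?thesis by blast
  qed
  moreover have "\<exists>E'. cograph {..<n} E' \<and> E \<subseteq> E' \<and>
     (\<forall>x y. {x, y} \<in> E' - E \<longrightarrow> (\<exists>N\<in>set Ns. x \<in> N \<and> y \<in> N))"
    if R: "between n (sandwich_matrix E Ns) R" and P4: "P4_free_on R {..<n}" for R
  proof -
    \<comment> \<open>\<open>R\<close> is unrestricted on the diagonal and outside
      \<open>{..<n}\<close>, hence the cut to pairs of distinct vertices.\<close>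
    define E' where "E' = {{u, v} | u v. u < n \<and> v < n \<and> u \<noteq> v \<and> R u v}"
    have sym: "R v u" if "R u v" for u v using that R sympD unfolding between_def by metis
    have mem: "{u, v} \<in> E' \<longleftrightarrow> u < n \<and> v < n \<and> u \<noteq> v \<and> R u v" for u v
      using sym unfolding E'_def by (auto simp: doubleton_eq_iff)
    have "simple_graph {..<n} E'" unfolding simple_graph_def E'_def by auto
    moreover have False if "induced_P4 {..<n} E' a b c d" for a b c d
      by (rule P4_free_onD[OF P4, of a b c d])
        (use that in \<open>auto simp: induced_P4_def mem\<close>)
    ultimately have "cograph {..<n} E'" unfolding cograph_def by blast
    moreover have "e \<in> E'" if e: "e \<in> E" for e
    proof -
      have "e \<subseteq> {..<n}" "card e = 2" using G e unfolding simple_graph_def by auto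
      then obtain u v where uv: "e = {u, v}" "u < n" "v < n" "u \<noteq> v"
        by (auto simp: card_2_iff)
      then show ?thesis using R e unfolding mem uv(1) between_def sandwich_matrix_def by auto
    qed
    moreover have "\<exists>N\<in>set Ns. x \<in> N \<and> y \<in> N" if "{x, y} \<in> E' - E" for x y
    proof -
      have "x < n" "y < n" "x \<noteq> y" "R x y" "{x, y} \<notin> E" using that mem by auto
      then show ?thesis
        using R unfolding between_def sandwich_matrix_def shared_def by metis
    qed
    ultimately show ?thesis by blast
  qed
  ultimately show ?thesis unfolding labeled_probe_cograph_def by blast
qed

section \<open>Time-bounded program logic\<close>

fun written :: "com \<Rightarrow> nat set" where
  "written Skip = {}"
| "written (Assign r e) = {r}"
| "written (Store e1 e2) = {}"
| "written (Seq p q) = written p \<union> written q"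
| "written (Cond b p q) = written p \<union> written q"
| "written (While b p) = written p"

lemma exec_regs_unwritten:
  "exec W p s t s' \<Longrightarrow> x \<notin> written p \<Longrightarrow> regs s' x = regs s x"
  by (induction rule: exec.induct) auto

text \<open>Since \<open>exec\<close> is deterministic, this is total correctness within the budget
  \<open>T\<close>.\<close>

definition runs :: "nat \<Rightarrow> com \<Rightarrow> state \<Rightarrow> nat \<Rightarrow> (state \<Rightarrow> bool) \<Rightarrow> bool" where
  "runs W p s T Q \<longleftrightarrow> (\<exists>t s'. exec W p s t s' \<and> t \<le> T \<and> Q s')"

text \<open>The consequence rule combined with the frame rule: the new postcondition may rely on the
  registers that \<open>p\<close> does not write.\<close>

lemma runs_mono:
  assumes "runs W p s T Q" "T \<le> T'"
    "\<And>s'. Q s' \<Longrightarrow> \<forall>x. x \<notin> written p \<longrightarrow> regs s' x = regs s x \<Longrightarrow> Q' s'"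
  shows "runs W p s T' Q'"
  using assms exec_regs_unwritten unfolding runs_def by (meson le_trans)

lemma runs_Skip: "Q s \<Longrightarrow> 1 \<le> T \<Longrightarrow> runs W Skip s T Q"
  unfolding runs_def using exec.Skip by blast

lemma runs_Assign:
  "Q (s\<lparr>regs := (regs s)(r := aval e s)\<rparr>) \<Longrightarrow> afits W e s \<Longrightarrow> 1 + acost e \<le> T \<Longrightarrow>
   runs W (Assign r e) s T Q"
  unfolding runs_def using exec.Assign by blast

lemma runs_Store:
  "Q (s\<lparr>mem := (mem s)(aval e1 s := aval e2 s)\<rparr>) \<Longrightarrow> afits W e1 s \<Longrightarrow> afits W e2 s \<Longrightarrow>
   1 + acost e1 + acost e2 \<le> T \<Longrightarrow> runs W (Store e1 e2) s T Q"
  unfolding runs_def using exec.Store by blast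

lemma runs_Seq:
  assumes "runs W p s T1 (\<lambda>s'. runs W q s' T2 Q)" "T1 + T2 \<le> T"
  shows "runs W (Seq p q) s T Q"
proof -
  obtain t1 s1 t2 s2 where *: "exec W p s t1 s1" "exec W q s1 t2 s2" "t1 \<le> T1" "t2 \<le> T2" "Q s2"
    using assms(1) unfolding runs_def by blast
  then have "t1 + t2 \<le> T" using assms(2) by linarith
  then show ?thesis using * exec.Seq unfolding runs_def by blast
qed

lemma runs_Cond:
  assumes "bfits W b s" "bval b s \<Longrightarrow> runs W p s T Q" "\<not> bval b s \<Longrightarrow> runs W q s T Q"
    "1 + bcost b + T \<le> T'"
  shows "runs W (Cond b p q) s T' Q"
proof (cases "bval b s")
  case True
  then obtain t s' where *: "exec W p s t s'" "t \<le> T" "Q s'"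
    using assms(2) unfolding runs_def by blast
  then have "1 + bcost b + t \<le> T'" using assms(4) by linarith
  then show ?thesis using exec.CondTrue[OF assms(1) True *(1)] * unfolding runs_def by blast
next
  case False
  then obtain t s' where *: "exec W q s t s'" "t \<le> T" "Q s'"
    using assms(3) unfolding runs_def by blast
  then have "1 + bcost b + t \<le> T'" using assms(4) by linarith
  then show ?thesis using exec.CondFalse[OF assms(1) False *(1)] * unfolding runs_def by blast
qed

text \<open>The invariants of loops speak about the memory only: the registers a loop body relies on are
  those it does not write, and these are covered by \<open>exec_regs_unwritten\<close>.\<close>

definition For :: "nat \<Rightarrow> nat \<Rightarrow> com \<Rightarrow> com" where
  "For r b p = Seq (Assign r (Const 0))
     (While (Less (Reg r) (Reg b)) (Seq p (Assign r (Add (Reg r) (Const 1)))))"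

lemma written_For [simp]: "written (For r b p) = insert r (written p)"
  unfolding For_def by auto

text \<open>Each test and each increment costs 4 steps, giving \<open>T + 8\<close> per remaining
  iteration and 4 for the failing test.\<close>

lemma runs_For_loop:
  assumes r: "r \<noteq> b" "r \<notin> written p" "b \<notin> written p" and W: "N < W" "1 < W"
    and step: "\<And>i s'. i < N \<Longrightarrow> I i (mem s') \<Longrightarrow> regs s' r = i \<Longrightarrow>
       \<forall>x. x \<notin> insert r (written p) \<longrightarrow> regs s' x = regs s x \<Longrightarrow>
       runs W p s' T (\<lambda>s''. I (Suc i) (mem s''))"
    and b: "regs s b = N"
    and s': "\<forall>x. x \<notin> insert r (written p) \<longrightarrow> regs s' x = regs s x" "regs s' r = i" "i \<le> N"
      "I i (mem s')"
  shows "runs W (While (Less (Reg r) (Reg b)) (Seq p (Assign r (Add (Reg r) (Const 1))))) s'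
    (4 + (N - i) * (T + 8)) (\<lambda>s''. I N (mem s''))"
  using s'
proof (induction "N - i" arbitrary: i s')
  case 0
  then have "i = N" "regs s' b = N" using b r by auto
  then show ?case
    using 0 W exec.WhileFalse[of W "Less (Reg r) (Reg b)" s'] unfolding runs_def by fastforce
next
  case (Suc j)
  have b': "regs s' b = N" and i: "i < N" using Suc b r by auto
  obtain t s1 where s1: "exec W p s' t s1" "t \<le> T" "I (Suc i) (mem s1)"
    using step[OF i Suc.prems(4,2,1)] unfolding runs_def by blast
  define s2 where "s2 = s1\<lparr>regs := (regs s1)(r := Suc i)\<rparr>"
  have r1: "regs s1 r = i" using exec_regs_unwritten[OF s1(1)] Suc.prems r by auto
  then have "exec W (Assign r (Add (Reg r) (Const 1))) s1 4 s2"
    using exec.Assign[of W "Add (Reg r) (Const 1)" s1 r] i W unfolding s2_def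
    by (simp add: eval_nat_numeral)
  then have body: "exec W (Seq p (Assign r (Add (Reg r) (Const 1)))) s' (t + 4) s2"
    using s1(1) exec.Seq by blast
  have "runs W (While (Less (Reg r) (Reg b)) (Seq p (Assign r (Add (Reg r) (Const 1))))) s2
    (4 + (N - Suc i) * (T + 8)) (\<lambda>s''. I N (mem s''))"
  proof (rule Suc.hyps(1))
    show "j = N - Suc i" using Suc.hyps by simp
    show "\<forall>x. x \<notin> insert r (written p) \<longrightarrow> regs s2 x = regs s x"
      using Suc.prems(1) exec_regs_unwritten[OF s1(1)] unfolding s2_def by simp
  qed (use i s1 in \<open>auto simp: s2_def\<close>)
  then obtain t2 s3 where s3: "exec W (While (Less (Reg r) (Reg b))
      (Seq p (Assign r (Add (Reg r) (Const 1))))) s2 t2 s3"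
    "t2 \<le> 4 + (N - Suc i) * (T + 8)" "I N (mem s3)" unfolding runs_def by blast
  have "exec W (While (Less (Reg r) (Reg b)) (Seq p (Assign r (Add (Reg r) (Const 1))))) s'
    (1 + bcost (Less (Reg r) (Reg b)) + (t + 4) + t2) s3"
    by (rule exec.WhileTrue[OF _ _ body s3(1)]) (use b' i Suc.prems W in auto)
  moreover have "1 + bcost (Less (Reg r) (Reg b)) + (t + 4) + t2 \<le> 4 + (N - i) * (T + 8)"
  proof -
    have "(N - i) * (T + 8) = (N - Suc i) * (T + 8) + (T + 8)"
      using i by (metis Suc_diff_Suc add.commute mult_Suc)
    then show ?thesis using s1 s3 by simp
  qed
  ultimately show ?case using s3 unfolding runs_def by blast
qed

text \<open>The product form of the bounds lets nested loops compose. The 14 consists of 8 per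
  iteration and 6 for the initialisation and the last test, which \<open>K\<close> and
  \<open>m\<close>, being at least 1, absorb; \<open>m\<close> is a bound for \<open>N\<close> that
  stays positive when there are no iterations.\<close>

lemma runs_For:
  assumes "I 0 (mem s)" "regs s b = N" "N < W" "1 < W" "N \<le> m" "1 \<le> m" "1 \<le> K"
    and "r \<noteq> b" "r \<notin> written p" "b \<notin> written p"
    and "\<And>i s'. i < N \<Longrightarrow> I i (mem s') \<Longrightarrow> regs s' r = i \<Longrightarrow>
       \<forall>x. x \<notin> insert r (written p) \<longrightarrow> regs s' x = regs s x \<Longrightarrow>
       runs W p s' (C * K) (\<lambda>s''. I (Suc i) (mem s''))"
  shows "runs W (For r b p) s ((C + 14) * (K * m)) (\<lambda>s'. I N (mem s'))"
  unfolding For_def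
proof (rule runs_Seq, rule runs_Assign)
  let ?s = "s\<lparr>regs := (regs s)(r := aval (Const 0) s)\<rparr>"
  show "runs W (While (Less (Reg r) (Reg b)) (Seq p (Assign r (Add (Reg r) (Const 1))))) ?s
    (4 + (N - 0) * (C * K + 8)) (\<lambda>s''. I N (mem s''))"
    by (rule runs_For_loop[where s = s]) (use assms in auto)
  have "N * (C * K + 8) \<le> m * (C * K + 8 * K)" using assms by (intro mult_mono) auto
  moreover have "6 * 1 \<le> 6 * (K * m)" using assms by (intro mult_left_mono) auto
  ultimately have "6 * 1 + N * (C * K + 8) \<le> 6 * (K * m) + m * (C * K + 8 * K)"
    by (rule add_mono[rotated])
  then show "2 + (4 + (N - 0) * (C * K + 8)) \<le> (C + 14) * (K * m)"
    by (simp add: algebra_simps)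
qed (use assms in auto)

text \<open>Indexing the invariant by the set of treated pairs hides the order of traversal from its
  users. The 28 is the overhead 14 of both loops.\<close>

lemma runs_For_pairs:
  assumes init: "I {} (mem s)" and n: "regs s b = n" "n < W" "1 < W" "n \<le> m" "1 \<le> m" "1 \<le> K"
    and r: "r1 \<noteq> b" "r2 \<noteq> b" "r1 \<noteq> r2" "r1 \<notin> written p" "r2 \<notin> written p" "b \<notin> written p"
    and step: "\<And>u v D s'. u < n \<Longrightarrow> v < n \<Longrightarrow> (u, v) \<notin> D \<Longrightarrow> I D (mem s') \<Longrightarrow>
       regs s' r1 = u \<Longrightarrow> regs s' r2 = v \<Longrightarrow>
       \<forall>x. x \<notin> insert r1 (insert r2 (written p)) \<longrightarrow> regs s' x = regs s x \<Longrightarrow>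
       runs W p s' (C * K) (\<lambda>s''. I (insert (u, v) D) (mem s''))"
  shows "runs W (For r1 b (For r2 b p)) s ((C + 28) * (K * m * m))
    (\<lambda>s'. I ({..<n} \<times> {..<n}) (mem s'))"
proof -
  \<comment> \<open>The pairs that precede \<open>(u, v)\<close> lexicographically.\<close>
  define J where "J u v = {..<u :: nat} \<times> {..<n} \<union> {u} \<times> {..<v :: nat}" for u v
  have J: "J u n = J (Suc u) 0" "J u (Suc v) = insert (u, v) (J u v)" "J 0 0 = {}"
    "J n 0 = {..<n} \<times> {..<n}" "(u, v) \<notin> J u v" for u v
    unfolding J_def by (auto simp: less_Suc_eq)
  have "runs W (For r1 b (For r2 b p)) s ((C + 14 + 14) * (K * m * m)) (\<lambda>s'. I (J n 0) (mem s'))"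
  proof (rule runs_For[where I = "\<lambda>u. I (J u 0)"])
    fix u and s' :: state assume u: "u < n" "I (J u 0) (mem s')" "regs s' r1 = u"
      "\<forall>x. x \<notin> insert r1 (written (For r2 b p)) \<longrightarrow> regs s' x = regs s x"
    have "runs W (For r2 b p) s' ((C + 14) * (K * m)) (\<lambda>s''. I (J u n) (mem s''))"
    proof (rule runs_For[where I = "\<lambda>v. I (J u v)"])
      fix v and s'' :: state assume v: "v < n" "I (J u v) (mem s'')" "regs s'' r2 = v"
        "\<forall>x. x \<notin> insert r2 (written p) \<longrightarrow> regs s'' x = regs s' x"
      show "runs W p s'' (C * K) (\<lambda>s''. I (J u (Suc v)) (mem s''))"
        unfolding J(2) by (rule step) (use u v r J in auto)
    qed (use n r u in simp_all)
    then show "runs W (For r2 b p) s' ((C + 14) * (K * m)) (\<lambda>s''. I (J (Suc u) 0) (mem s''))"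
      using J by simp
  qed (use n r init J in simp_all)
  then show ?thesis using J by (simp add: add.assoc)
qed

section \<open>The recognition program\<close>

text \<open>Registers 2 and 3 hold \<open>n\<close> and \<open>k\<close>; registers 4, 5 and 6 hold the base addresses of the label
  vectors, of the current partition and of the components under construction, where the last two
  arrays lie behind the input; registers 7 to 10 are loop counters.\<close>

definition edge_at :: "nat \<Rightarrow> nat \<Rightarrow> aexp" where
  "edge_at r1 r2 = Add (Const 2) (Add (Mul (Reg r1) (Reg 2)) (Reg r2))"

definition label_at :: "nat \<Rightarrow> nat \<Rightarrow> aexp" where
  "label_at r1 r2 = Add (Reg 4) (Add (Mul (Reg r1) (Reg 3)) (Reg r2))"

definition part_at :: "nat \<Rightarrow> aexp" where
  "part_at r = Add (Reg 5) (Reg r)"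

definition comp_at :: "nat \<Rightarrow> aexp" where
  "comp_at r = Add (Reg 6) (Reg r)"

lemma acost_at [simp]:
  "acost (edge_at r1 r2) = 7" "acost (label_at r1 r2) = 7" "acost (part_at r) = 3" "acost (comp_at r) = 3"
  unfolding edge_at_def label_at_def part_at_def comp_at_def by simp_all

text \<open>The input adjacency matrix is overwritten by the matrix coding the sandwich problem.\<close>

definition mark_shared :: com where
  "mark_shared = For 10 3
     (Cond (BAnd (Equal (Load (label_at 8 10)) (Const 1)) (Equal (Load (label_at 9 10)) (Const 1)))
       (Cond (Equal (Load (edge_at 8 9)) (Const 1))
         (Store (Const 0) (Const 0))
         (Store (edge_at 8 9) (Const 0)))
       Skip)"

definition encode :: com where
  "encode = For 8 2 (For 9 2 (Seq
     (Cond (Equal (Load (edge_at 8 9)) (Const 0)) (Store (edge_at 8 9) (Const 2)) Skip)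
     mark_shared))"

text \<open>The union operation of quick-find. Both labels are saved in registers first, because the
  scan also overwrites the entry of the vertex in register 8.\<close>

definition merge :: "nat \<Rightarrow> com" where
  "merge t = Cond
     (BAnd (Equal (Load (part_at 8)) (Load (part_at 9))) (Equal (Load (edge_at 8 9)) (Const t)))
     (Seq (Assign 11 (Load (comp_at 8))) (Seq (Assign 12 (Load (comp_at 9)))
       (For 10 2 (Cond (Equal (Load (comp_at 10)) (Reg 11)) (Store (comp_at 10) (Reg 12)) Skip))))
     Skip"

text \<open>The components grow in a second array, starting from singletons, as the tests must refer
  to the old partition until all pairs are treated.\<close>

definition refine :: "nat \<Rightarrow> com" where
  "refine t = Seq (For 8 2 (Store (comp_at 8) (Reg 8)))
     (Seq (For 8 2 (For 9 2 (merge t)))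
       (For 8 2 (Store (part_at 8) (Load (comp_at 8)))))"

definition check_discrete :: com where
  "check_discrete = For 8 2 (For 9 2 (Cond
     (BAnd (BNot (Equal (Reg 8) (Reg 9))) (Equal (Load (part_at 8)) (Load (part_at 9))))
     (Store (Const 0) (Const 0)) Skip))"

definition init_regs :: com where
  "init_regs =
     Seq (Assign 2 (Load (Const 0)))
     (Seq (Assign 3 (Load (Const 1)))
     (Seq (Assign 4 (Add (Const 2) (Mul (Reg 2) (Reg 2))))
     (Seq (Assign 5 (Add (Reg 4) (Mul (Reg 2) (Reg 3))))
          (Assign 6 (Add (Reg 5) (Reg 2))))))"

text \<open>The verdict in cell 0 starts as 1 and can only be cleared. The initial partition into
  one part is already present, since all cells behind the input are 0.\<close>

definition recognizer :: com where
  "recognizer = Seq init_regs (Seq (Store (Const 0) (Const 1)) (Seq encode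
     (Seq (For 7 2 (Seq (refine 1) (refine 2))) (Seq check_discrete (Assign 0 (Load (Const 0)))))))"

lemma written_simps [simp]:
  "written mark_shared = {10}" "written (merge t) = {10, 11, 12}"
  "written (refine t) = {8, 9, 10, 11, 12}"
  unfolding mark_shared_def merge_def refine_def by auto

lemma row_major_less:
  assumes "u < a" "v < (b::nat)"
  shows "u * b + v < a * b"
proof -
  have "u * b + v < Suc u * b" using assms by simp
  also have "\<dots> \<le> a * b" using assms by (intro mult_right_mono) auto
  finally show ?thesis .
qed

lemma row_major_eq:
  assumes "v < (b::nat)" "v' < b"
  shows "u * b + v = u' * b + v' \<longleftrightarrow> u = u' \<and> v = v'"
proof
  assume eq: "u * b + v = u' * b + v'"
  have "(u * b + v) div b = u" "(u' * b + v') div b = u'" using assms by auto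
  then show "u = u' \<and> v = v'" using eq by auto
qed simp

text \<open>The condition of \<open>components\<close> with its first half restricted to the treated
  pairs \<open>D\<close>; the second half keeps the classes from becoming too coarse.\<close>

definition merge_inv where
  "merge_inv n A t L D M \<longleftrightarrow>
     (\<forall>(u, v)\<in>D. L u = L v \<longrightarrow> A u v = t \<longrightarrow> M u = M v) \<and>
     (\<forall>S. closed n A t L S \<longrightarrow> (\<forall>x<n. \<forall>y<n. M x = M y \<longrightarrow> (x \<in> S \<longleftrightarrow> y \<in> S)))"

lemma merge_inv_init: "merge_inv n A t L {} (\<lambda>x. x)"
  unfolding merge_inv_def by auto

lemma merge_inv_final: "merge_inv n A t L ({..<n} \<times> {..<n}) M \<Longrightarrow> components n A t L M"
  unfolding merge_inv_def components_def by blast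

lemma merge_inv_skip:
  "merge_inv n A t L D M \<Longrightarrow> \<not> (L u = L v \<and> A u v = t) \<Longrightarrow> merge_inv n A t L (insert (u, v) D) M"
  unfolding merge_inv_def by blast

text \<open>Equal labels stay equal under relabelling, so treated pairs remain united. A closed set
  contains both or neither of \<open>u\<close> and \<open>v\<close>, so it is not crossed by the
  united class either.\<close>

lemma merge_inv_step:
  assumes M: "merge_inv n A t L D M" and uv: "L u = L v" "A u v = t" "u < n" "v < n"
  shows "merge_inv n A t L (insert (u, v) D) (\<lambda>w. if M w = M u then M v else M w)"
  unfolding merge_inv_def
proof (intro conjI ballI allI impI, goal_cases)
  case (1 p)
  then show ?case using M unfolding merge_inv_def by (auto split: if_splits)
next
  case (2 S x y)
  have same: "x \<in> S \<longleftrightarrow> y \<in> S" if "x < n" "y < n" "M x = M y" for x y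
    using M 2(1) that unfolding merge_inv_def by blast
  have "u \<in> S \<longleftrightarrow> v \<in> S" using 2(1) uv unfolding closed_def by blast
  then show ?case
    using same[OF 2(2,3)] same[OF 2(2) uv(3)] same[OF 2(3) uv(3)] same[OF 2(2) uv(4)]
      same[OF 2(3) uv(4)] 2(4) by (auto split: if_splits)
qed

section \<open>Memory layout and its representation invariant\<close>

locale machine =
  fixes n k W :: nat and P :: "nat \<Rightarrow> nat \<Rightarrow> bool"
  assumes W: "n * n + n * k + 2 * n + k + 3 \<le> W"
begin

definition edge_addr :: "nat \<Rightarrow> nat \<Rightarrow> nat" where "edge_addr u v = 2 + (u * n + v)"
definition label_addr :: "nat \<Rightarrow> nat \<Rightarrow> nat" where "label_addr u i = 2 + n * n + (u * k + i)"
definition part_addr :: "nat \<Rightarrow> nat" where "part_addr u = 2 + n * n + n * k + u"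
definition comp_addr :: "nat \<Rightarrow> nat" where "comp_addr u = 2 + n * n + n * k + n + u"

definition layout :: "state \<Rightarrow> bool" where
  "layout s \<longleftrightarrow> regs s 2 = n \<and> regs s 3 = k \<and> regs s 4 = 2 + n * n \<and>
     regs s 5 = 2 + n * n + n * k \<and> regs s 6 = 2 + n * n + n * k + n"

text \<open>Memory cell 0, whose input value \<open>n\<close> is kept in a register, holds the verdict \<open>f\<close>.\<close>

definition rep :: "(nat \<Rightarrow> nat \<Rightarrow> nat) \<Rightarrow> (nat \<Rightarrow> nat) \<Rightarrow> (nat \<Rightarrow> nat) \<Rightarrow> bool \<Rightarrow> (nat \<Rightarrow> nat) \<Rightarrow> bool" where
  "rep A L M f m \<longleftrightarrow> m 0 = of_bool f \<and>
     (\<forall>u<n. \<forall>v<n. m (edge_addr u v) = A u v \<and> A u v \<le> 2) \<and>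
     (\<forall>u<n. \<forall>i<k. m (label_addr u i) = of_bool (P u i)) \<and>
     (\<forall>u<n. m (part_addr u) = L u \<and> L u < n) \<and>
     (\<forall>u<n. m (comp_addr u) = M u \<and> M u < n)"

text \<open>The summand \<open>k\<close> in the assumption on \<open>W\<close> matters for
  \<open>n = 0\<close>, where \<open>n * k\<close> vanishes.\<close>

lemma bounds: "n < W" "k < W" "2 < W" "Suc 0 < W" "0 < W"
  using W by auto

lemma addr_less:
  assumes "u < n"
  shows "v < n \<Longrightarrow> edge_addr u v < 2 + n * n" "i < k \<Longrightarrow> label_addr u i < 2 + n * n + n * k"
    "part_addr u < 2 + n * n + n * k + n" "comp_addr u < W"
  using assms row_major_less[of u n v n] row_major_less[of u n i k] W
  unfolding edge_addr_def label_addr_def part_addr_def comp_addr_def by linarith+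

lemma addr_ge:
  "2 + n * n \<le> label_addr u i" "2 + n * n + n * k \<le> part_addr u"
  "2 + n * n + n * k + n \<le> comp_addr u"
  unfolding label_addr_def part_addr_def comp_addr_def by simp_all

lemma addr_inj:
  "v < n \<Longrightarrow> v' < n \<Longrightarrow> edge_addr u v = edge_addr u' v' \<longleftrightarrow> u = u' \<and> v = v'"
  "part_addr u = part_addr u' \<longleftrightarrow> u = u'" "comp_addr u = comp_addr u' \<longleftrightarrow> u = u'"
  unfolding edge_addr_def part_addr_def comp_addr_def using row_major_eq by auto

lemma addr_neq:
  assumes "u < n"
  shows "v < n \<Longrightarrow> label_addr u' i \<noteq> edge_addr u v" "v < n \<Longrightarrow> part_addr u' \<noteq> edge_addr u v"
    "v < n \<Longrightarrow> comp_addr u' \<noteq> edge_addr u v" "i < k \<Longrightarrow> part_addr u' \<noteq> label_addr u i"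
    "i < k \<Longrightarrow> comp_addr u' \<noteq> label_addr u i" "comp_addr u' \<noteq> part_addr u"
  using addr_less(1)[OF assms, of v] addr_less(2)[OF assms, of i] addr_less(3)[OF assms]
    addr_ge(1)[of u' i] addr_ge(2,3)[of u']
  by linarith+

lemma addr_neq_0:
  "edge_addr u v \<noteq> 0" "label_addr u i \<noteq> 0" "part_addr u \<noteq> 0" "comp_addr u \<noteq> 0"
  unfolding edge_addr_def label_addr_def part_addr_def comp_addr_def by simp_all

lemmas addr_simps = addr_inj addr_neq addr_neq[symmetric] addr_neq_0

lemma rep_set_verdict: "rep A L M f m \<Longrightarrow> rep A L M False (m(0 := 0))"
  unfolding rep_def by (auto simp: addr_neq_0)

lemma rep_set_edge:
  assumes "rep A L M f m" "u < n" "v < n" "x \<le> 2"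
  shows "rep (\<lambda>u' v'. if u' = u \<and> v' = v then x else A u' v') L M f (m(edge_addr u v := x))"
  using assms unfolding rep_def by (auto simp: addr_simps)

lemma rep_set_part:
  assumes "rep A L M f m" "u < n" "x < n"
  shows "rep A (L(u := x)) M f (m(part_addr u := x))"
  using assms unfolding rep_def by (auto simp: addr_simps)

lemma rep_set_comp:
  assumes "rep A L M f m" "u < n" "x < n"
  shows "rep A L (M(u := x)) f (m(comp_addr u := x))"
  using assms unfolding rep_def by (auto simp: addr_simps)

lemma rep_cong:
  assumes "rep A L M f m" "\<And>u v. u < n \<Longrightarrow> v < n \<Longrightarrow> A' u v = A u v"
    "\<And>u. u < n \<Longrightarrow> L' u = L u" "\<And>u. u < n \<Longrightarrow> M' u = M u" "f' = f"
  shows "rep A' L' M' f' m"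
  using assms unfolding rep_def by simp

lemma rep_read:
  assumes "rep A L M f m" "u < n"
  shows "v < n \<Longrightarrow> m (edge_addr u v) = A u v" "v < n \<Longrightarrow> A u v < W"
    "i < k \<Longrightarrow> m (label_addr u i) = of_bool (P u i)"
    "m (part_addr u) = L u" "L u < n" "L u < W" "m (comp_addr u) = M u" "M u < n" "M u < W"
  using assms bounds le_less_trans[of "A u v" 2 W] less_trans[of "L u" n W]
    less_trans[of "M u" n W] unfolding rep_def by simp_all

lemma aval_at:
  assumes "layout s"
  shows "aval (edge_at r1 r2) s = edge_addr (regs s r1) (regs s r2)"
    "aval (label_at r1 r2) s = label_addr (regs s r1) (regs s r2)"
    "aval (part_at r) s = part_addr (regs s r)" "aval (comp_at r) s = comp_addr (regs s r)"
  using assms unfolding layout_def edge_at_def label_at_def part_at_def comp_at_def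
    edge_addr_def label_addr_def part_addr_def comp_addr_def by simp_all

lemma afits_at:
  assumes "layout s"
  shows "regs s r1 < n \<Longrightarrow> regs s r2 < n \<Longrightarrow> afits W (edge_at r1 r2) s"
    "regs s r1 < n \<Longrightarrow> regs s r2 < k \<Longrightarrow> afits W (label_at r1 r2) s"
    "regs s r < n \<Longrightarrow> afits W (part_at r) s" "regs s r < n \<Longrightarrow> afits W (comp_at r) s"
  using assms W row_major_less[of "regs s r1" n "regs s r2" n] row_major_less[of "regs s r1" n "regs s r2" k]
  unfolding layout_def edge_at_def label_at_def part_at_def comp_at_def by auto

lemmas at_simps = aval_at afits_at rep_read bounds

section \<open>Correctness and cost of the phases\<close>

definition shares :: "nat \<Rightarrow> nat \<Rightarrow> nat \<Rightarrow> bool" where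
  "shares u v i \<longleftrightarrow> (\<exists>j<i. P u j \<and> P v j)"

lemma shares_simps: "shares u v (Suc i) \<longleftrightarrow> shares u v i \<or> P u i \<and> P v i" "\<not> shares u v 0"
  unfolding shares_def by (auto simp: less_Suc_eq)

text \<open>The matrix entry after the first \<open>i\<close> labels have been scanned;
  \<open>i = k\<close> gives the code of the sandwich problem.\<close>

definition entry :: "(nat \<Rightarrow> nat \<Rightarrow> bool) \<Rightarrow> nat \<Rightarrow> nat \<Rightarrow> nat \<Rightarrow> nat" where
  "entry e u v i = (if e u v then 1 else if shares u v i then 0 else 2)"

text \<open>A common label turns the entry of a non-edge into 0. The entry of an edge stays 1, and
  the common label clears the verdict, since it violates independence.\<close>

lemma runs_mark_shared:
  assumes s: "layout s" "regs s 8 = u" "regs s 9 = v" "u < n" "v < n"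
    and rep: "rep A L M f (mem s)" "A u v = entry e u v 0"
  shows "runs W mark_shared s (66 * max 1 k)
    (\<lambda>s'. rep (\<lambda>u' v'. if u' = u \<and> v' = v then entry e u v k else A u' v') L M
       (f \<and> \<not> (e u v \<and> shares u v k)) (mem s'))"
proof -
  have [simp]: "of_bool b = Suc 0 \<longleftrightarrow> b" for b by (cases b) auto
  let ?I = "\<lambda>i. rep (\<lambda>u' v'. if u' = u \<and> v' = v then entry e u v i else A u' v') L M
       (f \<and> \<not> (e u v \<and> shares u v i))"
  have "runs W mark_shared s ((52 + 14) * (1 * max 1 k)) (\<lambda>s'. ?I k (mem s'))"
    unfolding mark_shared_def
  proof (rule runs_For[where I = ?I])
    show "?I 0 (mem s)" by (rule rep_cong[OF rep(1)]) (use rep(2) in \<open>auto simp: shares_simps\<close>)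
  next
    fix i and s' :: state
    assume i: "i < k" "?I i (mem s')" "regs s' 10 = i" and
      "\<forall>x. x \<notin> insert 10 (written (Cond (BAnd (Equal (Load (label_at 8 10)) (Const 1)) (Equal (Load (label_at 9 10)) (Const 1)))
       (Cond (Equal (Load (edge_at 8 9)) (Const 1)) (Store (Const 0) (Const 0)) (Store (edge_at 8 9) (Const 0)))
       Skip)) \<longrightarrow> regs s' x = regs s x"
    then have s': "layout s'" "regs s' 8 = u" "regs s' 9 = v" using s unfolding layout_def by auto
    note [simp] = s' s(4,5) i(1,3) at_simps rep_read[OF i(2)]
    have entry_W: "entry e u v i < W" using bounds unfolding entry_def by auto
    show "runs W (Cond (BAnd (Equal (Load (label_at 8 10)) (Const 1)) (Equal (Load (label_at 9 10)) (Const 1)))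
       (Cond (Equal (Load (edge_at 8 9)) (Const 1)) (Store (Const 0) (Const 0)) (Store (edge_at 8 9) (Const 0)))
       Skip) s' (52 * 1) (\<lambda>s''. ?I (Suc i) (mem s''))"
    \<comment> \<open>The outer test costs 22 steps, so 52 leaves room for a branch of 29.\<close>
    proof (rule runs_Cond[where T = 29])
      assume "bval (BAnd (Equal (Load (label_at 8 10)) (Const 1)) (Equal (Load (label_at 9 10)) (Const 1))) s'"
      then have P: "P u i" "P v i" by (auto split: if_splits)
      show "runs W (Cond (Equal (Load (edge_at 8 9)) (Const 1)) (Store (Const 0) (Const 0))
          (Store (edge_at 8 9) (Const 0))) s' 29 (\<lambda>s''. ?I (Suc i) (mem s''))"
      proof (rule runs_Cond[where T = 10])
        assume "bval (Equal (Load (edge_at 8 9)) (Const 1)) s'"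
        then have e: "e u v" by (auto simp: entry_def split: if_splits)
        show "runs W (Store (Const 0) (Const 0)) s' 10 (\<lambda>s''. ?I (Suc i) (mem s''))"
          by (rule runs_Store, simp, rule rep_cong[OF rep_set_verdict[OF i(2)]])
            (use P e in \<open>auto simp: shares_simps entry_def\<close>)
      next
        assume "\<not> bval (Equal (Load (edge_at 8 9)) (Const 1)) s'"
        then have e: "\<not> e u v" by (auto simp: entry_def split: if_splits)
        show "runs W (Store (edge_at 8 9) (Const 0)) s' 10 (\<lambda>s''. ?I (Suc i) (mem s''))"
          by (rule runs_Store, simp, rule rep_cong[OF rep_set_edge[OF i(2), of u v 0]])
            (use P e in \<open>auto simp: shares_simps entry_def\<close>)
      qed (use entry_W in auto)
    next
      assume "\<not> bval (BAnd (Equal (Load (label_at 8 10)) (Const 1)) (Equal (Load (label_at 9 10)) (Const 1))) s'"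
      then have P: "\<not> (P u i \<and> P v i)" by (auto split: if_splits)
      show "runs W Skip s' 29 (\<lambda>s''. ?I (Suc i) (mem s''))"
        by (rule runs_Skip, rule rep_cong[OF i(2)])
          (use P in \<open>auto simp: shares_simps entry_def\<close>)
    qed auto
  qed (use s bounds in \<open>auto simp: layout_def\<close>)
  then show ?thesis by simp
qed

lemma runs_encode:
  assumes s: "layout s" and rep: "rep (\<lambda>u v. of_bool (e u v)) L M True (mem s)"
  shows "runs W encode s (114 * (max 1 k * max 1 n * max 1 n))
    (\<lambda>s'. rep (\<lambda>u v. entry e u v k) L M (\<forall>u<n. \<forall>v<n. \<not> (e u v \<and> shares u v k)) (mem s'))"
proof -
  let ?A = "\<lambda>D u v. if (u, v) \<in> D then entry e u v k else of_bool (e u v)"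
  let ?f = "\<lambda>D. \<forall>(u, v)\<in>D. \<not> (e u v \<and> shares u v k)"
  let ?I = "\<lambda>D. rep (?A D) L M (?f D)"
  let ?p = "Seq (Cond (Equal (Load (edge_at 8 9)) (Const 0)) (Store (edge_at 8 9) (Const 2)) Skip) mark_shared"
  have "runs W encode s ((86 + 28) * (max 1 k * max 1 n * max 1 n)) (\<lambda>s'. ?I ({..<n} \<times> {..<n}) (mem s'))"
    unfolding encode_def
  proof (rule runs_For_pairs[where I = ?I])
    show "?I {} (mem s)" using rep by simp
  next
    fix u v D and s' :: state
    assume u: "u < n" "v < n" "(u, v) \<notin> D" and I: "?I D (mem s')" "regs s' 8 = u" "regs s' 9 = v"
      and "\<forall>x. x \<notin> insert 8 (insert 9 (written ?p)) \<longrightarrow> regs s' x = regs s x"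
    then have s': "layout s'" using s unfolding layout_def by auto
    note [simp] = s' u I(2,3) at_simps rep_read[OF I(1)]
    \<comment> \<open>Between the two commands the entry is that for no scanned labels, as
      \<open>runs_mark_shared\<close> expects. As \<open>(u, v)\<close> is untreated, its entry
      before was still the input bit.\<close>
    let ?J = "rep (\<lambda>u' v'. if u' = u \<and> v' = v then entry e u v 0 else ?A D u' v') L M (?f D)"
    have "runs W (Cond (Equal (Load (edge_at 8 9)) (Const 0)) (Store (edge_at 8 9) (Const 2)) Skip)
      s' 20 (\<lambda>s''. ?J (mem s''))"
    proof (rule runs_Cond[where T = 9])
      assume "bval (Equal (Load (edge_at 8 9)) (Const 0)) s'"
      then show "runs W (Store (edge_at 8 9) (Const 2)) s' 9 (\<lambda>s''. ?J (mem s''))"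
        by (intro runs_Store, simp, intro rep_cong[OF rep_set_edge[OF I(1), of u v 2]])
          (auto simp: entry_def shares_simps)
    next
      assume "\<not> bval (Equal (Load (edge_at 8 9)) (Const 0)) s'"
      then show "runs W Skip s' 9 (\<lambda>s''. ?J (mem s''))"
        by (intro runs_Skip rep_cong[OF I(1)]) (auto simp: entry_def)
    qed auto
    then have "runs W ?p s' (20 + 66 * max 1 k) (\<lambda>s''. ?I (insert (u, v) D) (mem s''))"
    proof (intro runs_Seq, elim runs_mono)
      fix s'' :: state assume J: "?J (mem s'')"
        and "\<forall>x. x \<notin> written (Cond (Equal (Load (edge_at 8 9)) (Const 0)) (Store (edge_at 8 9) (Const 2)) Skip)
          \<longrightarrow> regs s'' x = regs s' x"
      then have "regs s'' x = regs s' x" for x by simp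
      then have s'': "layout s''" "regs s'' 8 = u" "regs s'' 9 = v" using s' unfolding layout_def by auto
      show "runs W mark_shared s'' (66 * max 1 k) (\<lambda>s''. ?I (insert (u, v) D) (mem s''))"
        by (rule runs_mono[OF runs_mark_shared[OF s'' u(1,2) J]]) (auto elim!: rep_cong)
    qed auto
    then show "runs W ?p s' (86 * max 1 k) (\<lambda>s''. ?I (insert (u, v) D) (mem s''))"
      by (rule runs_mono) auto
  qed (use s bounds in \<open>auto simp: layout_def\<close>)
  then show ?thesis by (rule runs_mono) (auto elim!: rep_cong)
qed

lemma runs_relabel:
  assumes s: "layout s" "regs s 11 = a" "regs s 12 = b" "a < n" "b < n"
    and rep: "rep A L M f (mem s)"
  shows "runs W (For 10 2 (Cond (Equal (Load (comp_at 10)) (Reg 11)) (Store (comp_at 10) (Reg 12)) Skip)) s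
    (34 * max 1 n) (\<lambda>s'. rep A L (\<lambda>w. if M w = a then b else M w) f (mem s'))"
proof -
  let ?I = "\<lambda>i. rep A L (\<lambda>w. if w < i \<and> M w = a then b else M w) f"
  let ?p = "Cond (Equal (Load (comp_at 10)) (Reg 11)) (Store (comp_at 10) (Reg 12)) Skip"
  have "runs W (For 10 2 ?p) s ((20 + 14) * (1 * max 1 n)) (\<lambda>s'. ?I n (mem s'))"
  proof (rule runs_For[where I = ?I])
    fix i and s' :: state
    assume i: "i < n" "?I i (mem s')" "regs s' 10 = i"
      and "\<forall>x. x \<notin> insert 10 (written ?p) \<longrightarrow> regs s' x = regs s x"
    then have s': "layout s'" "regs s' 11 = a" "regs s' 12 = b" using s unfolding layout_def by auto
    have ab: "a < W" "b < W" using s bounds by auto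
    note [simp] = s' s(4,5) i(1,3) at_simps rep_read[OF i(2)] ab
    show "runs W ?p s' (20 * 1) (\<lambda>s''. ?I (Suc i) (mem s''))"
    proof (rule runs_Cond[where T = 5])
      assume "bval (Equal (Load (comp_at 10)) (Reg 11)) s'"
      then show "runs W (Store (comp_at 10) (Reg 12)) s' 5 (\<lambda>s''. ?I (Suc i) (mem s''))"
        by (intro runs_Store, simp, intro rep_cong[OF rep_set_comp[OF i(2), of i b]])
          (auto simp: less_Suc_eq)
    next
      assume "\<not> bval (Equal (Load (comp_at 10)) (Reg 11)) s'"
      then show "runs W Skip s' 5 (\<lambda>s''. ?I (Suc i) (mem s''))"
        by (intro runs_Skip rep_cong[OF i(2)]) (auto simp: less_Suc_eq)
    qed (use rep_read(9)[OF i(2,1)] in auto)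
  qed (use s bounds rep in \<open>auto simp: layout_def\<close>)
  then show ?thesis by (rule runs_mono) (auto elim!: rep_cong)
qed

lemma runs_merge:
  assumes s: "layout s" "regs s 8 = u" "regs s 9 = v" "u < n" "v < n" "t \<le> 2"
    and rep: "rep A L M f (mem s)" and inv: "merge_inv n A t L D M"
  shows "runs W (merge t) s (70 * max 1 n)
    (\<lambda>s'. \<exists>M'. rep A L M' f (mem s') \<and> merge_inv n A t L (insert (u, v) D) M')"
    (is "runs _ _ _ _ ?Q")
proof -
  note [simp] = s at_simps rep_read[OF rep] bounds
  have t: "t < W" using s(6) bounds(3) by linarith
  let ?r = "For 10 2 (Cond (Equal (Load (comp_at 10)) (Reg 11)) (Store (comp_at 10) (Reg 12)) Skip)"
  have "runs W (merge t) s (21 + (10 + 34 * max 1 n)) ?Q"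
    unfolding merge_def
  proof (rule runs_Cond[where T = "10 + 34 * max 1 n"])
    assume "bval (BAnd (Equal (Load (part_at 8)) (Load (part_at 9))) (Equal (Load (edge_at 8 9)) (Const t))) s"
    then have uv: "L u = L v" "A u v = t" by simp_all
    show "runs W (Seq (Assign 11 (Load (comp_at 8))) (Seq (Assign 12 (Load (comp_at 9))) ?r)) s
      (10 + 34 * max 1 n) ?Q"
    proof (rule runs_Seq, rule runs_Assign, rule runs_Seq, rule runs_Assign)
      let ?s1 = "s\<lparr>regs := (regs s)(11 := aval (Load (comp_at 8)) s)\<rparr>"
      let ?s = "?s1\<lparr>regs := (regs ?s1)(12 := aval (Load (comp_at 9)) ?s1)\<rparr>"
      have s1: "layout (s\<lparr>regs := (regs s)(11 := x)\<rparr>)" for x using s unfolding layout_def by simp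
      have l2: "layout ?s" using s unfolding layout_def by simp
      have s2: "regs ?s 11 = M u" "regs ?s 12 = M v" "rep A L M f (mem ?s)"
        using rep by (simp_all add: s1)
      show "runs W ?r ?s (34 * max 1 n) ?Q"
        by (rule runs_mono[OF runs_relabel[OF l2 s2(1,2) _ _ s2(3)]])
          (use merge_inv_step[OF inv uv] in auto)
      show "afits W (Load (comp_at 9)) ?s1" by (simp add: s1)
    qed auto
  next
    assume "\<not> bval (BAnd (Equal (Load (part_at 8)) (Load (part_at 9))) (Equal (Load (edge_at 8 9)) (Const t))) s"
    then have uv: "\<not> (L u = L v \<and> A u v = t)" by simp
    show "runs W Skip s (10 + 34 * max 1 n) ?Q"
      using merge_inv_skip[OF inv uv] rep by (intro runs_Skip) auto
  qed (use t rep_read(2,6)[OF rep] in auto)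
  then show ?thesis by (rule runs_mono) auto
qed

lemma runs_refine:
  assumes s: "layout s" and t: "t \<le> 2" and rep: "rep A L M f (mem s)"
  shows "runs W (refine t) s (140 * (max 1 n * max 1 n * max 1 n))
    (\<lambda>s'. \<exists>L' M'. rep A L' M' f (mem s') \<and> components n A t L L')"
proof -
  let ?n = "max 1 n"
  have 1: "runs W (For 8 2 (Store (comp_at 8) (Reg 8))) s ((5 + 14) * (1 * ?n))
    (\<lambda>s'. rep A L (\<lambda>x. if x < n then x else M x) f (mem s'))"
  proof (rule runs_For[where I = "\<lambda>i. rep A L (\<lambda>x. if x < i then x else M x) f"])
    fix i and s' :: state
    assume i: "i < n" "rep A L (\<lambda>x. if x < i then x else M x) f (mem s')" "regs s' 8 = i"
      and "\<forall>x. x \<notin> insert 8 (written (Store (comp_at 8) (Reg 8))) \<longrightarrow> regs s' x = regs s x"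
    then have s': "layout s'" using s unfolding layout_def by auto
    show "runs W (Store (comp_at 8) (Reg 8)) s' (5 * 1)
      (\<lambda>s''. rep A L (\<lambda>x. if x < Suc i then x else M x) f (mem s''))"
      by (rule runs_Store, simp add: i s' at_simps, rule rep_cong[OF rep_set_comp[OF i(2,1,1)]])
        (use i s' less_trans[OF i(1) bounds(1)] in \<open>auto simp: at_simps less_Suc_eq\<close>)
  qed (use s bounds rep in \<open>auto simp: layout_def\<close>)
  let ?J = "\<lambda>D m. \<exists>M'. rep A L M' f m \<and> merge_inv n A t L D M'"
  have 2: "runs W (For 8 2 (For 9 2 (merge t))) s' ((70 + 28) * (?n * ?n * ?n))
     (\<lambda>s''. ?J ({..<n} \<times> {..<n}) (mem s''))" if s': "layout s'" "?J {} (mem s')" for s' :: state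
  proof (rule runs_For_pairs[where I = ?J])
    fix u v D and s'' :: state
    assume u: "u < n" "v < n" "regs s'' 8 = u" "regs s'' 9 = v" and J: "?J D (mem s'')"
      and "\<forall>x. x \<notin> insert 8 (insert 9 (written (merge t))) \<longrightarrow> regs s'' x = regs s' x"
    then have "layout s''" using s' unfolding layout_def by auto
    then show "runs W (merge t) s'' (70 * ?n) (\<lambda>s'''. ?J (insert (u, v) D) (mem s'''))"
      using J runs_merge u t by blast
  qed (use s' bounds in \<open>auto simp: layout_def\<close>)
  have 3: "runs W (For 8 2 (Store (part_at 8) (Load (comp_at 8)))) s' ((9 + 14) * (1 * ?n))
    (\<lambda>s'. rep A (\<lambda>x. if x < n then M' x else L x) M' f (mem s'))"
    if s': "layout s'" "rep A L M' f (mem s')" for s' :: state and M'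
  proof (rule runs_For[where I = "\<lambda>i. rep A (\<lambda>x. if x < i then M' x else L x) M' f"])
    fix i and s'' :: state
    assume i: "i < n" "rep A (\<lambda>x. if x < i then M' x else L x) M' f (mem s'')" "regs s'' 8 = i"
      and "\<forall>x. x \<notin> insert 8 (written (Store (part_at 8) (Load (comp_at 8)))) \<longrightarrow> regs s'' x = regs s' x"
    then have s'': "layout s''" using s' unfolding layout_def by auto
    note [simp] = i(1,3) s'' at_simps rep_read[OF i(2,1)]
    show "runs W (Store (part_at 8) (Load (comp_at 8))) s'' (9 * 1)
      (\<lambda>s''. rep A (\<lambda>x. if x < Suc i then M' x else L x) M' f (mem s''))"
      by (rule runs_Store, simp, rule rep_cong[OF rep_set_part[OF i(2,1), of "M' i"]])
        (auto simp: less_Suc_eq)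
  qed (use s' bounds in \<open>auto simp: layout_def\<close>)
  let ?Q = "\<lambda>s'. \<exists>L' M'. rep A L' M' f (mem s') \<and> components n A t L L'"
  have "runs W (refine t) s (19 * ?n + (98 * (?n * ?n * ?n) + 23 * ?n)) ?Q"
    unfolding refine_def
  proof (rule runs_Seq, rule runs_mono[OF 1])
    fix s1 :: state assume s1: "rep A L (\<lambda>x. if x < n then x else M x) f (mem s1)"
      "\<forall>x. x \<notin> written (For 8 2 (Store (comp_at 8) (Reg 8))) \<longrightarrow> regs s1 x = regs s x"
    then have l1: "layout s1" using s unfolding layout_def by simp
    have "rep A L (\<lambda>x. x) f (mem s1)" by (rule rep_cong[OF s1(1)]) auto
    then have "?J {} (mem s1)" using merge_inv_init by blast
    then have "runs W (For 8 2 (For 9 2 (merge t))) s1 (98 * (?n * ?n * ?n))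
      (\<lambda>s2. runs W (For 8 2 (Store (part_at 8) (Load (comp_at 8)))) s2 (23 * ?n) ?Q)"
    proof (rule runs_mono[OF 2[OF l1]], goal_cases)
      case (2 s2)
      then obtain M' where M': "rep A L M' f (mem s2)" "components n A t L M'"
        using merge_inv_final by blast
      have l2: "layout s2" using l1 2(2) unfolding layout_def by simp
      show ?case
      proof (rule runs_mono[OF 3[OF l2 M'(1)]], goal_cases)
        case (2 s3)
        have "rep A M' M' f (mem s3)" by (rule rep_cong[OF 2(1)]) auto
        then show ?case using M'(2) by blast
      qed simp
    qed simp
    then show "runs W (Seq (For 8 2 (For 9 2 (merge t))) (For 8 2 (Store (part_at 8) (Load (comp_at 8)))))
      s1 (98 * (?n * ?n * ?n) + 23 * ?n) ?Q" by (rule runs_Seq) simp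
  qed auto
  \<comment> \<open>With \<open>n\<close> bounded by its cube the budget is 19 + 98 + 23 =
    140.\<close>
  moreover have "?n * 1 \<le> ?n * (?n * ?n)" by (intro mult_left_mono) auto
  ultimately show ?thesis by (elim runs_mono) (auto simp: mult.assoc)
qed


lemma runs_rounds:
  assumes s: "layout s" and rep: "rep A (\<lambda>_. 0) M f (mem s)"
  shows "runs W (For 7 2 (Seq (refine 1) (refine 2))) s (294 * (max 1 n * max 1 n * max 1 n * max 1 n))
    (\<lambda>s'. \<exists>L M. rep A L M f (mem s') \<and> refinement_inv n A n L)"
proof -
  let ?n = "max 1 n"
  let ?I = "\<lambda>i m. \<exists>L M. rep A L M f m \<and> refinement_inv n A i L"
  let ?p = "Seq (refine 1) (refine 2)"
  \<comment> \<open>A round consists of two refinements of cost 140 each, and the loop adds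
    14.\<close>
  have "runs W (For 7 2 ?p) s ((280 + 14) * (?n * ?n * ?n * ?n)) (\<lambda>s'. ?I n (mem s'))"
  proof (rule runs_For[where I = ?I])
    show "?I 0 (mem s)" using rep refinement_inv_init by blast
  next
    fix i and s' :: state
    assume I: "?I i (mem s')" and "\<forall>x. x \<notin> insert 7 (written ?p) \<longrightarrow> regs s' x = regs s x"
    then have s': "layout s'" using s unfolding layout_def by auto
    obtain L M where L: "rep A L M f (mem s')" "refinement_inv n A i L" using I by blast
    show "runs W ?p s' (280 * (?n * ?n * ?n)) (\<lambda>s''. ?I (Suc i) (mem s''))"
    proof (rule runs_Seq[where ?T1.0 = "140 * (?n * ?n * ?n)" and ?T2.0 = "140 * (?n * ?n * ?n)"], rule runs_mono[OF runs_refine[OF s' _ L(1)]], goal_cases)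
      case (3 s1)
      then obtain L1 M1 where L1: "rep A L1 M1 f (mem s1)" "components n A 1 L L1" by blast
      have "layout s1" using 3(2) s' unfolding layout_def by simp
      then show ?case
        by (rule runs_mono[OF runs_refine[OF _ _ L1(1)]])
          (use refinement_inv_step[OF L(2) L1(2)] in auto)
    qed auto
  qed (use s bounds in \<open>auto simp: layout_def\<close>)
  then show ?thesis by simp
qed

lemma runs_check_discrete:
  assumes s: "layout s" and rep: "rep A L M f (mem s)"
  shows "runs W check_discrete s (48 * (max 1 n * max 1 n))
    (\<lambda>s'. rep A L M (f \<and> inj_on L {..<n}) (mem s'))"
proof -
  let ?I = "\<lambda>D. rep A L M (f \<and> (\<forall>(u, v)\<in>D. u \<noteq> v \<longrightarrow> L u \<noteq> L v))"
  let ?b = "BAnd (BNot (Equal (Reg 8) (Reg 9))) (Equal (Load (part_at 8)) (Load (part_at 9)))"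
  let ?p = "Cond ?b (Store (Const 0) (Const 0)) Skip"
  have "runs W check_discrete s ((20 + 28) * (1 * max 1 n * max 1 n)) (\<lambda>s'. ?I ({..<n} \<times> {..<n}) (mem s'))"
    unfolding check_discrete_def
  proof (rule runs_For_pairs[where I = ?I])
    fix u v D and s' :: state
    assume u: "u < n" "v < n" and I: "?I D (mem s')" "regs s' 8 = u" "regs s' 9 = v"
      and "\<forall>x. x \<notin> insert 8 (insert 9 (written ?p)) \<longrightarrow> regs s' x = regs s x"
    then have s': "layout s'" using s unfolding layout_def by auto
    note [simp] = s' u I(2,3) at_simps rep_read[OF I(1)]
    show "runs W ?p s' (20 * 1) (\<lambda>s''. ?I (insert (u, v) D) (mem s''))"
    proof (rule runs_Cond[where T = 5])
      assume "bval ?b s'"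
      then show "runs W (Store (Const 0) (Const 0)) s' 5 (\<lambda>s''. ?I (insert (u, v) D) (mem s''))"
        by (intro runs_Store, simp, intro rep_cong[OF rep_set_verdict[OF I(1)]]) auto
    next
      assume "\<not> bval ?b s'"
      then show "runs W Skip s' 5 (\<lambda>s''. ?I (insert (u, v) D) (mem s''))"
        by (intro runs_Skip rep_cong[OF I(1)]) auto
    qed (use less_trans[OF u(1) bounds(1)] less_trans[OF u(2) bounds(1)] in auto)
  qed (use s rep bounds in \<open>auto simp: layout_def\<close>)
  then show ?thesis by (rule runs_mono) (auto elim!: rep_cong simp: inj_on_def)
qed

section \<open>Assembling the recognizer\<close>

lemma runs_init_regs:
  assumes "mem s 0 = n" "mem s 1 = k"
  shows "runs W init_regs s 23 (\<lambda>s'. layout s' \<and> mem s' = mem s)"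
  unfolding init_regs_def
  by (rule runs_Seq[where ?T1.0 = 3 and ?T2.0 = 20], rule runs_Assign,
      rule runs_Seq[where ?T1.0 = 3 and ?T2.0 = 17], rule runs_Assign,
      rule runs_Seq[where ?T1.0 = 6 and ?T2.0 = 11], rule runs_Assign,
      rule runs_Seq[where ?T1.0 = 6 and ?T2.0 = 5], rule runs_Assign, rule runs_Assign)
    (use assms W in \<open>auto simp: layout_def\<close>)

text \<open>The phases are chained from the last to the first, each fact covering all remaining
  commands.\<close>

lemma runs_recognizer:
  assumes in_n: "mem s 0 = n" "mem s 1 = k" and sym: "\<And>u v. e u v = e v u"
    and in_e: "\<And>u v. u < n \<Longrightarrow> v < n \<Longrightarrow> mem s (edge_addr u v) = of_bool (e u v)"
    and in_P: "\<And>u i. u < n \<Longrightarrow> i < k \<Longrightarrow> mem s (label_addr u i) = of_bool (P u i)"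
    and in_0: "\<And>a. 2 + n * n + n * k \<le> a \<Longrightarrow> mem s a = 0"
  shows "runs W recognizer s (500 * (max 1 k * max 1 n ^ 5))
    (\<lambda>s'. regs s' 0 = of_bool ((\<forall>u<n. \<forall>v<n. \<not> (e u v \<and> shares u v k)) \<and>
       solvable n (\<lambda>u v. entry e u v k) (\<lambda>_. 0)))"
    (is "runs _ _ _ _ (\<lambda>s'. regs s' 0 = of_bool (?ind \<and> solvable n ?A _))")
proof -
  let ?n = "max 1 n" and ?k = "max 1 k"
  let ?Q = "\<lambda>s'. regs s' 0 = of_bool (?ind \<and> solvable n ?A (\<lambda>_. 0))"
  have A_sym: "?A u v = ?A v u" for u v
    using sym unfolding entry_def shares_def by (auto simp: conj_commute)
  let ?final = "Assign 0 (Load (Const 0))"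
  have final: "runs W (Seq check_discrete ?final) s' (48 * (?n * ?n) + 3) ?Q"
    if s': "layout s'" and rep: "rep ?A L M ?ind (mem s')" and L: "refinement_inv n ?A n L" for s' L M
  proof (rule runs_Seq[where ?T1.0 = "48 * (?n * ?n)" and ?T2.0 = "3"], rule runs_mono[OF runs_check_discrete[OF s' rep]], goal_cases)
    case (2 s2)
    show ?case
      by (rule runs_Assign)
        (use 2 bounds refinement_inv_inj[OF L A_sym] in \<open>auto simp: rep_def\<close>)
  qed auto
  let ?rounds = "For 7 2 (Seq (refine 1) (refine 2))"
  have rounds: "runs W (Seq ?rounds (Seq check_discrete ?final)) s'
    (294 * (?n * ?n * ?n * ?n) + (48 * (?n * ?n) + 3)) ?Q"
    if s': "layout s'" and rep: "rep ?A (\<lambda>_. 0) M ?ind (mem s')" for s' M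
  proof (rule runs_Seq[where ?T1.0 = "294 * (?n * ?n * ?n * ?n)" and ?T2.0 = "48 * (?n * ?n) + 3"], rule runs_mono[OF runs_rounds[OF s' rep]], goal_cases)
    case (2 s2)
    then have "layout s2" using s' unfolding layout_def by simp
    then show ?case using 2 final by blast
  qed auto
  have encode: "runs W (Seq encode (Seq ?rounds (Seq check_discrete ?final))) s'
    (114 * (?k * ?n * ?n) + (294 * (?n * ?n * ?n * ?n) + (48 * (?n * ?n) + 3))) ?Q"
    if s': "layout s'" and rep: "rep (\<lambda>u v. of_bool (e u v)) (\<lambda>_. 0) M True (mem s')" for s' M
  proof (rule runs_Seq[where ?T1.0 = "114 * (?k * ?n * ?n)" and ?T2.0 = "294 * (?n * ?n * ?n * ?n) + (48 * (?n * ?n) + 3)"], rule runs_mono[OF runs_encode[OF s' rep]], goal_cases)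
    case (2 s2)
    then have "layout s2" using s' unfolding layout_def encode_def by simp
    then show ?case using 2 rounds by blast
  qed auto
  have "runs W recognizer s (23 + (3 +
    (114 * (?k * ?n * ?n) + (294 * (?n * ?n * ?n * ?n) + (48 * (?n * ?n) + 3))))) ?Q"
    unfolding recognizer_def
  proof (rule runs_Seq[where ?T1.0 = "23" and ?T2.0 = "3 + (114 * (?k * ?n * ?n) + (294 * (?n * ?n * ?n * ?n) + (48 * (?n * ?n) + 3)))"], rule runs_mono[OF runs_init_regs[OF in_n]], goal_cases)
    case (2 s2)
    show ?case
    proof (rule runs_Seq[where ?T1.0 = "3" and ?T2.0 = "114 * (?k * ?n * ?n) + (294 * (?n * ?n * ?n * ?n) + (48 * (?n * ?n) + 3))"], rule runs_Store)
      let ?s = "s2\<lparr>mem := (mem s2)(aval (Const 0) s2 := aval (Const 1) s2)\<rparr>"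
      have "layout ?s" using 2 unfolding layout_def by simp
      moreover have "rep (\<lambda>u v. of_bool (e u v)) (\<lambda>_. 0) (\<lambda>_. 0) True (mem ?s)"
        unfolding rep_def using 2 in_e in_P in_0[OF addr_ge(2)] in_0[OF add_leD1[OF addr_ge(3)]]
        by (auto simp: addr_neq_0)
      ultimately show "runs W (Seq encode (Seq ?rounds (Seq check_discrete ?final))) ?s
        (114 * (?k * ?n * ?n) + (294 * (?n * ?n * ?n * ?n) + (48 * (?n * ?n) + 3))) ?Q"
        by (rule encode)
    qed (use bounds in auto)
  qed auto
  moreover have "23 + (3 + (114 * (?k * ?n * ?n) + (294 * (?n * ?n * ?n * ?n) + (48 * (?n * ?n) + 3))))
    \<le> 500 * (?k * ?n ^ 5)"
  proof -
    \<comment> \<open>Every summand is at most its coefficient times \<open>?k * ?n ^ 5\<close>, and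
      the coefficients add up to 485.\<close>
    have "?k * ?n ^ 2 \<le> ?k * ?n ^ 5" "?n ^ 4 \<le> ?n ^ 5" "?n ^ 2 \<le> ?n ^ 5"
      by (auto intro!: mult_left_mono power_increasing)
    moreover have "1 * ?n ^ 5 \<le> ?k * ?n ^ 5" by (intro mult_right_mono) auto
    moreover have "1 \<le> ?n ^ 5" by simp
    moreover have "?k * ?n * ?n = ?k * ?n ^ 2" "?n * ?n * ?n * ?n = ?n ^ 4" "?n * ?n = ?n ^ 2"
      by (simp_all add: eval_nat_numeral)
    ultimately show ?thesis by linarith
  qed
  ultimately show ?thesis by (rule runs_mono) auto
qed

end

theorem mainTheorem1:
  "\<exists>(p :: com) (c :: nat) (d :: nat).
     \<forall>(n :: nat) (k :: nat) (E :: nat set set) (Ns :: nat set list).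
       simple_graph {..<n} E \<and> length Ns = k \<and> (\<forall>N\<in>set Ns. N \<subseteq> {..<n}) \<longrightarrow>
       (\<exists>t s'. exec ((n + k + 2) ^ d) p (input_state n E Ns) t s' \<and>
          regs s' 0 = (if labeled_probe_cograph {..<n} E Ns then 1 else 0) \<and>
          t \<le> c * (max 1 k * max 1 n ^ 5))"
\<comment> \<open>The exponent 2 suffices because \<open>(n + k + 2) ^ 2\<close> dominates the
  polynomial that \<open>machine\<close> demands of \<open>W\<close>.\<close>
proof (rule exI[of _ recognizer], rule exI[of _ 500], rule exI[of _ 2], intro allI impI, elim conjE)
  fix n k :: nat and E :: "nat set set" and Ns :: "nat set list"
  assume G: "simple_graph {..<n} E" and k: "length Ns = k" and Ns: "\<forall>N\<in>set Ns. N \<subseteq> {..<n}"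
  let ?P = "\<lambda>u i. u \<in> Ns ! i" and ?e = "\<lambda>u v. {u, v} \<in> E" and ?s = "input_state n E Ns"
  interpret machine n k "(n + k + 2) ^ 2" ?P
    by unfold_locales (simp add: power2_eq_square algebra_simps)
  have shares: "shares u v k \<longleftrightarrow> shared Ns u v" for u v
    unfolding shares_def shared_def using k by (metis in_set_conv_nth)
  \<comment> \<open>After all \<open>k\<close> labels, sharing a scanned label is the same as lying
    in a common set of \<open>Ns\<close>.\<close>
  have "(\<lambda>u v. entry ?e u v k) = sandwich_matrix E Ns"
    unfolding entry_def sandwich_matrix_def shares by auto
  then have correct: "labeled_probe_cograph {..<n} E Ns \<longleftrightarrow> (\<forall>u<n. \<forall>v<n. \<not> (?e u v \<and> shares u v k)) \<and>
      solvable n (\<lambda>u v. entry ?e u v k) (\<lambda>_. 0)"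
    unfolding labeled_probe_cograph_iff_solvable[OF G Ns] solvable_const shares by simp
  have "runs ((n + k + 2) ^ 2) recognizer ?s (500 * (max 1 k * max 1 n ^ 5))
    (\<lambda>s'. regs s' 0 = of_bool (labeled_probe_cograph {..<n} E Ns))"
    unfolding correct
  proof (rule runs_recognizer)
    show "mem ?s 0 = n" "mem ?s 1 = k" using k by (auto simp: input_state_def input_mem_def)
    show "{u, v} \<in> E \<longleftrightarrow> {v, u} \<in> E" for u v by (simp add: insert_commute)
    show "mem ?s (edge_addr u v) = of_bool ({u, v} \<in> E)" if "u < n" "v < n" for u v
      using row_major_less[OF that] that
      by (simp add: input_state_def input_mem_def edge_addr_def)
    show "mem ?s (label_addr u i) = of_bool (u \<in> Ns ! i)" if "u < n" "i < k" for u i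
      using row_major_less[OF that] that k
      by (simp add: input_state_def input_mem_def label_addr_def)
    show "mem ?s a = 0" if "2 + n * n + n * k \<le> a" for a
      using that k by (simp add: input_state_def input_mem_def)
  qed
  then show "\<exists>t s'. exec ((n + k + 2) ^ 2) recognizer ?s t s' \<and>
      regs s' 0 = (if labeled_probe_cograph {..<n} E Ns then 1 else 0) \<and>
      t \<le> 500 * (max 1 k * max 1 n ^ 5)"
    unfolding runs_def of_bool_def by blast
qed

end
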